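(* Let $d,\beta\in\mathbb N$, $L_1,\dots,L_\beta>0$, and $k\in\{1,\dots,\beta\}$. Let $f\colon\mathbb R^d\to\mathbb R^d$ be $\beta$-times continuously differentiable with $\sup_{x\in\mathbb R^d}\|D^jf(x)\|_{\mathsf{op}}\le L_j$ for all $j\in\{1,\dots,\beta\}$ (no bound is imposed on $f$ itself). Let $\Delta t_0>0$ and assume $\Delta t\in[0,\Delta t_0]$. Then $$\sup_{x\in\mathbb R^d}\|D^k_x\Upsilon(f,\Delta t,x)\|_{\mathsf{op}}\le C_k\big(\exp(L_1\Delta t)-1\big),$$ where $C_k>0$ depends only on $k$, $\Delta t_0$ and $L_1,\dots,L_k$.
   Context: For a Lipschitz $f\colon\mathbb R^d\to\mathbb R^d$, $U(f,x,\cdot)$ is the unique solution $u$ of $\dot u(t)=f(u(t))$, $u(0)=x$, and $\Upsilon(f,t,x):=U(f,x,t)-x$ is the increment. $D^k_x$ denotes the $k$-th derivative with respect to $x$, viewed as a $k$-multilinear map; for a $k$-multilinear map $A\colon(\mathbb R^d)^k\to\mathbb R^d$, $\|A\|_{\mathsf{op}}:=\sup\|A(v_1,\dots,v_k)\|_2$ over unit vectors $v_1,\dots,v_k$. *)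

theory Defs
  imports "HOL-Analysis.Analysis"
begin

text \<open>The constant in the theorem has to be chosen before the dimension \<open>d\<close>, so \<open>d\<close> cannot be
  encoded in a type. All spaces \<open>\<real>\<^sup>d\<close> are therefore realised inside one inner product space, the
  finitely supported real sequences: \<open>\<real>\<^sup>d\<close> is the set of sequences that vanish from index \<open>d\<close> on,
  and the norm of the type restricts to the Euclidean norm on it (lemma \<open>norm_Rd\<close>).\<close>

typedef rseq = "{x :: nat \<Rightarrow> real. finite {i. x i \<noteq> 0}}"
  morphisms coord Abs_rseq
  by (rule exI[of _ "\<lambda>_. 0"]) simp

setup_lifting type_definition_rseq

lemma finite_coord: "finite {i. coord x i \<noteq> 0}"
  using coord[of x] by simp

lemma rseq_eqI: "(\<And>i. coord x i = coord y i) \<Longrightarrow> x = y"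
  by (simp add: coord_inject[symmetric] fun_eq_iff)

instantiation rseq :: real_vector
begin

lift_definition zero_rseq :: rseq is "\<lambda>_. 0" by simp

lift_definition plus_rseq :: "rseq \<Rightarrow> rseq \<Rightarrow> rseq" is "\<lambda>x y i. x i + y i"
proof -
  fix x y :: "nat \<Rightarrow> real"
  assume "finite {i. x i \<noteq> 0}" "finite {i. y i \<noteq> 0}"
  then have "finite ({i. x i \<noteq> 0} \<union> {i. y i \<noteq> 0})" by simp
  then show "finite {i. x i + y i \<noteq> 0}" by (rule rev_finite_subset) auto
qed

lift_definition uminus_rseq :: "rseq \<Rightarrow> rseq" is "\<lambda>x i. - x i" by simp

lift_definition minus_rseq :: "rseq \<Rightarrow> rseq \<Rightarrow> rseq" is "\<lambda>x y i. x i - y i"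
proof -
  fix x y :: "nat \<Rightarrow> real"
  assume "finite {i. x i \<noteq> 0}" "finite {i. y i \<noteq> 0}"
  then have "finite ({i. x i \<noteq> 0} \<union> {i. y i \<noteq> 0})" by simp
  then show "finite {i. x i - y i \<noteq> 0}" by (rule rev_finite_subset) auto
qed

lift_definition scaleR_rseq :: "real \<Rightarrow> rseq \<Rightarrow> rseq" is "\<lambda>r x i. r * x i"
  by (erule rev_finite_subset) auto

instance
  by standard (transfer; simp add: fun_eq_iff algebra_simps)+

end

instantiation rseq :: real_inner
begin

definition inner_rseq :: "rseq \<Rightarrow> rseq \<Rightarrow> real"
  where "inner_rseq x y = (\<Sum>i | coord x i \<noteq> 0. coord x i * coord y i)"

definition norm_rseq :: "rseq \<Rightarrow> real"
  where "norm_rseq x = sqrt (inner x x)"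

definition dist_rseq :: "rseq \<Rightarrow> rseq \<Rightarrow> real"
  where "dist_rseq x y = norm (x - y)"

definition sgn_rseq :: "rseq \<Rightarrow> rseq"
  where "sgn_rseq x = x /\<^sub>R norm x"

definition uniformity_rseq :: "(rseq \<times> rseq) filter"
  where "uniformity_rseq = (INF e\<in>{0<..}. principal {(x, y). dist x y < e})"

definition open_rseq :: "rseq set \<Rightarrow> bool"
  where "open_rseq U \<longleftrightarrow> (\<forall>x\<in>U. eventually (\<lambda>(x', y). x' = x \<longrightarrow> y \<in> U) uniformity)"

lemma inner_rseq_superset:
  assumes "finite A" "{i. coord x i \<noteq> 0} \<subseteq> A"
  shows "inner x y = (\<Sum>i\<in>A. coord x i * coord y i)"
  unfolding inner_rseq_def using assms by (intro sum.mono_neutral_left) auto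

instance
proof
  fix x y z :: rseq and r :: real
  define A where "A = {i. coord x i \<noteq> 0} \<union> {i. coord y i \<noteq> 0}"
  have A: "finite A" "{i. coord x i \<noteq> 0} \<subseteq> A" "{i. coord y i \<noteq> 0} \<subseteq> A"
    by (auto simp: A_def finite_coord)
  have A': "{i. coord (x + y) i \<noteq> 0} \<subseteq> A" "{i. coord (r *\<^sub>R x) i \<noteq> 0} \<subseteq> A"
    by (auto simp: A_def plus_rseq.rep_eq scaleR_rseq.rep_eq)
  show "inner x y = inner y x"
    by (simp add: inner_rseq_superset[OF A(1) A(2)] inner_rseq_superset[OF A(1) A(3)] mult.commute)
  show "inner (x + y) z = inner x z + inner y z"
    by (simp add: inner_rseq_superset[OF A(1) A(2)] inner_rseq_superset[OF A(1) A(3)]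
        inner_rseq_superset[OF A(1) A'(1)] plus_rseq.rep_eq distrib_right sum.distrib)
  show "inner (r *\<^sub>R x) y = r * inner x y"
    by (simp add: inner_rseq_superset[OF A(1) A(2)] inner_rseq_superset[OF A(1) A'(2)]
        scaleR_rseq.rep_eq sum_distrib_left mult.assoc)
  show "0 \<le> inner x x"
    by (simp add: inner_rseq_def sum_nonneg)
  show "inner x x = 0 \<longleftrightarrow> x = 0"
  proof
    assume "inner x x = 0"
    then have "\<forall>i\<in>{i. coord x i \<noteq> 0}. coord x i * coord x i = 0"
      unfolding inner_rseq_def by (subst (asm) sum_nonneg_eq_0_iff) (auto simp: finite_coord)
    then show "x = 0"
      by (intro rseq_eqI) (auto simp: zero_rseq.rep_eq)
  qed (simp add: inner_rseq_def zero_rseq.rep_eq)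
qed (simp_all add: norm_rseq_def dist_rseq_def sgn_rseq_def uniformity_rseq_def open_rseq_def)

end

definition Rd :: "nat \<Rightarrow> rseq set"
  where "Rd d = {x. \<forall>i\<ge>d. coord x i = 0}"

lemma norm_Rd: "x \<in> Rd d \<Longrightarrow> norm x = L2_set (coord x) {..<d}"
proof -
  assume "x \<in> Rd d"
  then have "{i. coord x i \<noteq> 0} \<subseteq> {..<d}"
    by (auto simp: Rd_def not_le[symmetric])
  then show ?thesis
    by (simp add: norm_rseq_def inner_rseq_superset[OF finite_lessThan] L2_set_def power2_eq_square)
qed

text \<open>\<open>nth_deriv d g x [v\<^sub>1, \<dots>, v\<^sub>k]\<close> is \<open>D\<^sup>k g(x)(v\<^sub>1, \<dots>, v\<^sub>k)\<close>, by
  \<open>D\<^sup>k g(x)(v\<^sub>1, \<dots>, v\<^sub>k) = D(y \<mapsto> D\<^sup>k\<^sup>-\<^sup>1 g(y)(v\<^sub>2, \<dots>, v\<^sub>k))(x)(v\<^sub>1)\<close>. It is meaningful only for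
  \<open>x\<close> and \<open>v\<^sub>i\<close> in \<open>Rd d\<close>: a derivative within \<open>Rd d\<close> is unique on \<open>Rd d\<close>, but not off it.\<close>

fun nth_deriv :: "nat \<Rightarrow> (rseq \<Rightarrow> rseq) \<Rightarrow> rseq \<Rightarrow> rseq list \<Rightarrow> rseq" where
  "nth_deriv d g x [] = g x"
| "nth_deriv d g x (v # vs) = frechet_derivative (\<lambda>y. nth_deriv d g y vs) (at x within Rd d) v"

text \<open>As \<open>\<real>\<^sup>d\<close> is finite-dimensional, differentiability and continuity of the multilinear-map-valued
  \<open>D\<^sup>j g\<close> amount to those of \<open>x \<mapsto> D\<^sup>j g(x)(v\<^sub>1, \<dots>, v\<^sub>j)\<close> for all fixed arguments.\<close>

definition n_times_differentiable :: "nat \<Rightarrow> nat \<Rightarrow> (rseq \<Rightarrow> rseq) \<Rightarrow> bool"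
  where "n_times_differentiable d n g \<longleftrightarrow>
    (\<forall>vs. set vs \<subseteq> Rd d \<and> length vs < n \<longrightarrow> (\<lambda>x. nth_deriv d g x vs) differentiable_on Rd d)"

definition n_times_continuously_differentiable :: "nat \<Rightarrow> nat \<Rightarrow> (rseq \<Rightarrow> rseq) \<Rightarrow> bool"
  where "n_times_continuously_differentiable d n g \<longleftrightarrow>
    n_times_differentiable d n g \<and>
    (\<forall>vs. set vs \<subseteq> Rd d \<and> length vs = n \<longrightarrow> continuous_on (Rd d) (\<lambda>x. nth_deriv d g x vs))"

text \<open>The operator norm takes values in \<open>ennreal\<close>, so that suprema of unbounded sets are \<open>\<infinity>\<close>.\<close>

definition op_norm :: "nat \<Rightarrow> nat \<Rightarrow> (rseq list \<Rightarrow> rseq) \<Rightarrow> ennreal"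
  where "op_norm d k A =
    (SUP vs \<in> {vs. length vs = k \<and> (\<forall>v\<in>set vs. v \<in> Rd d \<and> norm v = 1)}. ennreal (norm (A vs)))"

text \<open>Solutions live on the whole time axis, so that uniqueness holds as functions of type
  \<open>real \<Rightarrow> rseq\<close> and the description operator in \<open>flow\<close> applies.\<close>

definition is_solution :: "nat \<Rightarrow> (rseq \<Rightarrow> rseq) \<Rightarrow> rseq \<Rightarrow> (real \<Rightarrow> rseq) \<Rightarrow> bool"
  where "is_solution d f x u \<longleftrightarrow>
    u 0 = x \<and> (\<forall>t. u t \<in> Rd d \<and> (u has_vector_derivative f (u t)) (at t))"

definition flow :: "nat \<Rightarrow> (rseq \<Rightarrow> rseq) \<Rightarrow> rseq \<Rightarrow> real \<Rightarrow> rseq"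
  where "flow d f x = (THE u. is_solution d f x u)"

definition increment :: "nat \<Rightarrow> (rseq \<Rightarrow> rseq) \<Rightarrow> real \<Rightarrow> rseq \<Rightarrow> rseq"
  where "increment d f t x = flow d f x t - x"

end

theory Submission
  imports Defs
begin

text \<open>Differentiating \<open>\<partial>\<^sub>t U = f(U)\<close> \<open>k\<close> times in \<open>x\<close> shows that \<open>w = D\<^sup>k U(v\<^sub>1, \<dots>, v\<^sub>k)\<close> should solve the
  linear equation \<open>w' = Df(U) w + r\<close>, where \<open>r\<close> consists of derivatives of \<open>f\<close> of order at most \<open>k\<close>
  applied to derivatives of \<open>U\<close> of order below \<open>k\<close>, and \<open>w(0) = 0\<close> for \<open>k \<ge> 2\<close>; for \<open>k = 1\<close>, the same
  holds for \<open>w - v\<^sub>1\<close> with \<open>r = Df(U) v\<^sub>1\<close>. By induction \<open>r\<close> is bounded by some \<open>M\<close> on \<open>[0, \<Delta>t\<^sub>0]\<close>, and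
  Gronwall's inequality yields the bound \<open>M / L\<^sub>1 (exp (L\<^sub>1 t) - 1)\<close>.

  That \<open>w\<close> exists and is the derivative is also proved by induction on \<open>k\<close>: the solution of the linear
  equation exists by Picard iteration, and the error of the corresponding first-order expansion of
  \<open>D\<^sup>k\<^sup>-\<^sup>1 U\<close> satisfies a linear differential inequality with inhomogeneity \<open>o(h)\<close> uniformly in time.\<close>

subsection \<open>The spaces \<open>\<real>\<^sup>d\<close>\<close>

text \<open>The type \<open>rseq\<close> is neither complete nor finite-dimensional. Limits and
  antiderivatives are therefore formed coordinatewise inside \<open>Rd d\<close>, and derivatives
  within \<open>Rd d\<close> are composed with \<open>proj d\<close>, so that their values on
  \<open>d\<close> unit vectors determine them. Smoothness is given only for constant directions;
  expanding each moving direction in the unit vectors reduces to that case.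

  When the equation for w is differentiated once more, differentiability of w in x must not be
  presupposed. The right-hand side is therefore expanded with w frozen at the base point, which
  involves only derivatives already known, and the increment of w is left to the Gronwall term.
  Since r is linear in the newest direction, solving the equation for the \<open>d\<close> unit
  directions suffices.

  The constant comes from counting: at order k the chain rule leaves fewer than k! terms without the
  k-th derivative of U, each at most (L_1 + ... + L_k) G^k, where G \<ge> 1 bounds the derivatives
  of U of order 1 to k - 1.\<close>

lift_definition unit_rseq :: "nat \<Rightarrow> rseq" is "\<lambda>i j. if j = i then 1 else 0"
  by simp

text \<open>The orthogonal projection onto \<open>Rd d\<close>. A derivative within
  \<open>Rd d\<close> is determined only in directions of \<open>Rd d\<close>; composition with
  \<open>proj d\<close> fixes its values elsewhere.\<close>

definition proj :: "nat \<Rightarrow> rseq \<Rightarrow> rseq"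
  where "proj d x = (\<Sum>b<d. coord x b *\<^sub>R unit_rseq b)"

lemma coord_simps [simp]:
  "coord (x + y) i = coord x i + coord y i"
  "coord (x - y) i = coord x i - coord y i"
  "coord (- x) i = - coord x i"
  "coord (c *\<^sub>R x) i = c * coord x i"
  "coord 0 i = 0"
  "coord (unit_rseq j) i = (if i = j then 1 else 0)"
  by (transfer; simp)+

lemma coord_sum [simp]: "coord (sum f A) i = (\<Sum>a\<in>A. coord (f a) i)"
  by (induction A rule: infinite_finite_induct) auto

lemma inner_unit_rseq: "inner (unit_rseq i) x = coord x i"
proof -
  have "{j. coord (unit_rseq i) j \<noteq> 0} = {i}" by auto
  then show ?thesis by (simp add: inner_rseq_def)
qed

lemma norm_unit_rseq [simp]: "norm (unit_rseq i) = 1"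
  by (simp add: norm_rseq_def inner_unit_rseq)

lemma abs_coord_le: "\<bar>coord x i\<bar> \<le> norm x"
  using Cauchy_Schwarz_ineq2[of "unit_rseq i" x] by (simp add: inner_unit_rseq)

lemma bounded_linear_coord: "bounded_linear (\<lambda>x. coord x i)"
  unfolding inner_unit_rseq[symmetric] by (rule bounded_linear_inner_right)

lemma subspace_Rd: "subspace (Rd d)"
  by (auto simp: subspace_def Rd_def)

lemma Rd_closed_ops [simp, intro]:
  "0 \<in> Rd d"
  "x \<in> Rd d \<Longrightarrow> y \<in> Rd d \<Longrightarrow> x + y \<in> Rd d"
  "x \<in> Rd d \<Longrightarrow> y \<in> Rd d \<Longrightarrow> x - y \<in> Rd d"
  "x \<in> Rd d \<Longrightarrow> c *\<^sub>R x \<in> Rd d"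
  "(\<And>a. a \<in> A \<Longrightarrow> g a \<in> Rd d) \<Longrightarrow> sum g A \<in> Rd d"
  "b < d \<Longrightarrow> unit_rseq b \<in> Rd d"
  using subspace_Rd[of d]
  by (auto simp: subspace_add subspace_diff subspace_scale subspace_sum Rd_def)

lemma Rd_sum_list [intro]: "(\<And>x. x \<in> set xs \<Longrightarrow> x \<in> Rd d) \<Longrightarrow> sum_list xs \<in> Rd d"
  by (induction xs) auto

lemma convex_Rd: "convex (Rd d)"
  by (rule subspace_imp_convex[OF subspace_Rd])

lemma coord_proj: "coord (proj d x) i = (if i < d then coord x i else 0)"
proof -
  have "coord (proj d x) i = (\<Sum>b<d. if b = i then coord x i else 0)"
    unfolding proj_def coord_sum by (rule sum.cong) auto
  then show ?thesis by simp
qed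

lemma proj_in_Rd [simp, intro]: "proj d x \<in> Rd d"
  by (auto simp: Rd_def coord_proj)

lemma proj_Rd [simp]: "x \<in> Rd d \<Longrightarrow> proj d x = x"
  by (rule rseq_eqI) (auto simp: coord_proj Rd_def)

lemma Rd_eq_sum: "x \<in> Rd d \<Longrightarrow> (\<Sum>b<d. coord x b *\<^sub>R unit_rseq b) = x"
  by (metis proj_Rd proj_def)

lemma norm_proj_le: "norm (proj d x) \<le> norm x"
proof -
  have *: "inner (proj d x) y = (\<Sum>b<d. coord x b * coord y b)" for y
    by (simp add: proj_def inner_sum_left inner_unit_rseq)
  have "norm (proj d x) * norm (proj d x) = inner (proj d x) (proj d x)"
    by (simp add: power2_norm_eq_inner[symmetric] power2_eq_square)
  also have "\<dots> = inner (proj d x) x"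
    unfolding * by (simp add: coord_proj)
  also have "\<dots> \<le> norm (proj d x) * norm x"
    by (rule norm_cauchy_schwarz)
  finally show ?thesis
    by (metis mult_le_cancel_left norm_ge_zero not_le order_antisym_conv order.trans)
qed

lemma bounded_linear_proj: "bounded_linear (proj d)"
  by (rule bounded_linear_intro[where K = 1])
    (auto intro: rseq_eqI simp: coord_proj norm_proj_le)

section \<open>Convergence inside a finite-dimensional subspace\<close>

lemma tendsto_Rd:
  assumes "\<And>n. v n \<in> Rd d" "\<And>b. b < d \<Longrightarrow> (\<lambda>n. coord (v n) b) \<longlonglongrightarrow> c b"
  shows "v \<longlonglongrightarrow> (\<Sum>b<d. c b *\<^sub>R unit_rseq b)"
proof -
  have "(\<lambda>n. \<Sum>b<d. coord (v n) b *\<^sub>R unit_rseq b) \<longlonglongrightarrow> (\<Sum>b<d. c b *\<^sub>R unit_rseq b)"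
    by (intro tendsto_sum tendsto_scaleR assms(2)) auto
  then show ?thesis by (simp add: Rd_eq_sum[OF assms(1)])
qed

text \<open>The real coordinate sequences are Cauchy, and their limits reassemble to a point of
  \<open>Rd d\<close>; \<open>rseq\<close> itself is not complete. The explicit rate later makes
  Picard iteration converge uniformly on bounded time intervals.\<close>

lemma geometric_sequence_converges_Rd:
  assumes v: "\<And>n. v n \<in> Rd d" and le: "\<And>n. norm (v (Suc n) - v n) \<le> C / 2 ^ n"
  shows "\<exists>l\<in>Rd d. \<forall>n. norm (l - v n) \<le> 2 * C / 2 ^ n"
proof -
  \<comment> \<open>\<open>2 - 2 / 2 ^ k\<close> is the geometric sum of \<open>1 / 2 ^ i\<close>
    over \<open>i < k\<close>.\<close>
  have step: "norm (v (n + k) - v n) \<le> (2 - 2 / 2 ^ k) * (C / 2 ^ n)" for n k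
  proof (induction k)
    case (Suc k)
    have "norm (v (n + Suc k) - v n) \<le> norm (v (n + k) - v n) + norm (v (Suc (n + k)) - v (n + k))"
      by (metis add_Suc_right add.commute diff_add_cancel diff_diff_eq2 norm_triangle_ineq)
    also have "\<dots> \<le> (2 - 2 / 2 ^ k) * (C / 2 ^ n) + C / 2 ^ (n + k)"
      by (intro add_mono Suc le)
    also have "\<dots> = (2 - 2 / 2 ^ Suc k) * (C / 2 ^ n)"
      by (simp add: field_simps power_add)
    finally show ?case .
  qed simp
  have C: "0 \<le> C" using order.trans[OF norm_ge_zero le[of 0]] by simp
  have bound: "norm (v m - v n) \<le> 2 * C / 2 ^ n" if "n \<le> m" for m n
  proof -
    have "norm (v m - v n) \<le> (2 - 2 / 2 ^ (m - n)) * (C / 2 ^ n)"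
      using step[of n "m - n"] that by simp
    also have "\<dots> \<le> 2 * (C / 2 ^ n)"
      using C by (intro mult_right_mono) auto
    finally show ?thesis by simp
  qed
  have lim0: "(\<lambda>n. 2 * C / 2 ^ n) \<longlonglongrightarrow> 0"
    using tendsto_mult[OF tendsto_const[of "2 * C"] LIMSEQ_power_zero[of "1/2 :: real"]]
    by (simp add: power_one_over field_simps)
  have "convergent (\<lambda>n. coord (v n) b)" for b
  proof (intro Cauchy_convergent CauchyI)
    fix e :: real assume "0 < e"
    then have "0 < e / 2" by simp
    from order_tendstoD(2)[OF lim0 this] obtain N where N: "2 * C / 2 ^ N < e / 2"
      unfolding eventually_sequentially by blast
    have "\<bar>coord (v m) b - coord (v N) b\<bar> < e / 2" if "N \<le> m" for m
      using abs_coord_le[of "v m - v N" b] bound[OF that] N by simp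
    then have "\<bar>coord (v m) b - coord (v n) b\<bar> < e" if "N \<le> m" "N \<le> n" for m n
      using that by (smt (verit) field_sum_of_halves)
    then show "\<exists>M. \<forall>m\<ge>M. \<forall>n\<ge>M. norm (coord (v m) b - coord (v n) b) < e"
      by (intro exI[of _ N]) auto
  qed
  then obtain c where c: "\<And>b. (\<lambda>n. coord (v n) b) \<longlonglongrightarrow> c b"
    unfolding convergent_def by metis
  define l where "l = (\<Sum>b<d. c b *\<^sub>R unit_rseq b)"
  have "v \<longlonglongrightarrow> l" unfolding l_def by (rule tendsto_Rd[OF v c])
  then have "norm (l - v n) \<le> 2 * C / 2 ^ n" for n
    by (intro Lim_bounded[of "\<lambda>m. norm (v m - v n)" _ n] tendsto_norm tendsto_diff tendsto_const)
      (auto intro: bound)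
  moreover have "l \<in> Rd d" by (auto simp: l_def)
  ultimately show ?thesis by blast
qed

subsection \<open>Linear ordinary differential inequalities\<close>

text \<open>The norm of \<open>e\<close> need not be differentiable where \<open>e\<close> vanishes,
  so it is replaced by the larger, positive function \<open>n\<close>. It satisfies n' \<le> L n +
  b, hence (n + b / L) exp (- L s) is nonincreasing.\<close>

lemma gronwall:
  fixes e :: "real \<Rightarrow> 'a::real_inner"
  assumes L: "0 < L" and b: "0 \<le> b"
    and e: "\<And>t. t \<in> {0..T} \<Longrightarrow> (e has_vector_derivative e' t) (at t within {0..T})"
    and le: "\<And>t. t \<in> {0..T} \<Longrightarrow> norm (e' t) \<le> L * norm (e t) + b"
    and t: "t \<in> {0..T}"
  shows "norm (e t) \<le> norm (e 0) * exp (L * t) + b / L * (exp (L * t) - 1)"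
proof (rule field_le_epsilon)
  fix \<eta> :: real assume \<eta>: "0 < \<eta>"
  \<comment> \<open>At time \<open>t\<close> the regularisation costs
    \<open>\<delta> * exp (L * t)\<close>, which is \<open>\<eta>\<close> by this choice.\<close>
  define \<delta> where "\<delta> = \<eta> / exp (L * t)"
  have \<delta>: "0 < \<delta>" using \<eta> by (simp add: \<delta>_def)
  define n where "n s = sqrt (inner (e s) (e s) + \<delta>\<^sup>2)" for s
  have pos: "0 < inner (e s) (e s) + \<delta>\<^sup>2" for s
    using \<delta> by (simp add: add_nonneg_pos)
  have n_pos: "0 < n s" for s using pos by (simp add: n_def)
  have n_ge: "norm (e s) \<le> n s" for s
    by (simp add: n_def norm_eq_sqrt_inner)
  define \<psi> where "\<psi> s = (n s + b / L) * exp (- (L * s))" for s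
  have "\<psi> 0 \<ge> \<psi> t"
  proof (rule DERIV_nonpos_imp_decreasing_open[of 0 t \<psi>])
    show "0 \<le> t" using t by simp
    have "continuous_on {0..T} e"
      by (rule continuous_on_vector_derivative[OF e])
    then have ce: "continuous_on {0..t} e"
      by (rule continuous_on_subset) (use t in auto)
    show "continuous_on {0..t} \<psi>"
      unfolding \<psi>_def n_def by (intro continuous_intros ce)
    fix s assume s: "0 < s" "s < t"
    have "(e has_vector_derivative e' s) (at s)"
      using e[of s] s t by (simp add: at_within_Icc_at)
    then have d: "(e has_derivative (\<lambda>h. h *\<^sub>R e' s)) (at s)"
      by (simp add: has_vector_derivative_def)
    have "((\<lambda>s. inner (e s) (e s) + \<delta>\<^sup>2) has_real_derivative 2 * inner (e s) (e' s)) (at s)"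
      unfolding has_field_derivative_def
      by (auto intro!: derivative_eq_intros d simp: fun_eq_iff inner_commute)
    from DERIV_chain2[OF DERIV_real_sqrt[OF pos[of s]] this]
    have dn: "(n has_real_derivative inner (e s) (e' s) / n s) (at s)"
      by (simp add: n_def[abs_def] field_simps)
    have "(\<psi> has_real_derivative (inner (e s) (e' s) / n s - L * (n s + b / L)) * exp (- (L * s))) (at s)"
      unfolding \<psi>_def by (auto intro!: derivative_eq_intros dn simp: algebra_simps)
    moreover have "inner (e s) (e' s) / n s \<le> L * (n s + b / L)"
    proof -
      have "inner (e s) (e' s) \<le> norm (e s) * norm (e' s)"
        by (rule norm_cauchy_schwarz)
      also have "\<dots> \<le> n s * (L * n s + b)"
        using n_ge[of s] n_pos[of s] le[of s] s t L
        by (intro mult_mono) (auto intro: order.trans[OF le[of s]])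
      finally have "inner (e s) (e' s) / n s \<le> L * n s + b"
        using n_pos[of s] by (simp add: pos_divide_le_eq mult.commute)
      also have "\<dots> = L * (n s + b / L)" using L by (simp add: field_simps)
      finally show ?thesis .
    qed
    ultimately show "\<exists>y. (\<psi> has_real_derivative y) (at s) \<and> y \<le> 0"
      by (intro exI conjI) (auto simp: mult_le_0_iff)
  qed
  then have "n t + b / L \<le> (n 0 + b / L) * exp (L * t)"
    by (simp add: \<psi>_def exp_minus field_simps)
  moreover have "n 0 \<le> norm (e 0) + \<delta>"
    using sqrt_add_le_add_sqrt[of "inner (e 0) (e 0)" "\<delta>\<^sup>2"] \<delta>
    by (simp add: n_def norm_eq_sqrt_inner)
  ultimately have "n t + b / L \<le> (norm (e 0) + \<delta> + b / L) * exp (L * t)"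
    by (smt (verit) exp_gt_zero mult_right_mono)
  then show "norm (e t) \<le> norm (e 0) * exp (L * t) + b / L * (exp (L * t) - 1) + \<eta>"
    using n_ge[of t] by (simp add: \<delta>_def algebra_simps)
qed

subsection \<open>Iterated derivatives on \<open>\<real>\<^sup>d\<close>\<close>

text \<open>\<open>Rd d\<close> has empty interior in \<open>rseq\<close>, so uniqueness is reduced
  to one real variable: the line through \<open>x\<close> in direction \<open>v\<close> stays in
  \<open>Rd d\<close>, and both candidates yield the derivative along it.\<close>

lemma has_derivative_Rd_unique:
  assumes g: "(g has_derivative D) (at x within Rd d)" "(g has_derivative D') (at x within Rd d)"
    and x: "x \<in> Rd d" and v: "v \<in> Rd d"
  shows "D v = D' v"
proof -
  have line: "((\<lambda>s. x + s *\<^sub>R v) has_derivative (\<lambda>s. s *\<^sub>R v)) (at (0::real))"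
    by (auto intro!: derivative_eq_intros)
  have sub: "range (\<lambda>s. x + s *\<^sub>R v) \<subseteq> Rd d" using x v by auto
  have "((\<lambda>s. g (x + s *\<^sub>R v)) has_derivative (\<lambda>s. E (s *\<^sub>R v))) (at 0)"
    if "(g has_derivative E) (at x within Rd d)" for E
    using has_derivative_in_compose[OF line, of g E] has_derivative_subset[OF that sub] by simp
  from has_derivative_unique[OF this this, OF g] show ?thesis
    by (metis scaleR_one)
qed

lemma has_derivative_proj:
  assumes "(g has_derivative D) (at x within Rd d)" "x \<in> Rd d"
  shows "(g has_derivative (\<lambda>h. D (proj d h))) (at x within Rd d)"
  using assms bounded_linear_compose[OF has_derivative_bounded_linear[OF assms(1)] bounded_linear_proj]
  by (simp add: has_derivative_within_alt)

lemma frechet_derivative_Rd: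
  assumes "(g has_derivative D) (at x within Rd d)" "x \<in> Rd d" "v \<in> Rd d"
  shows "frechet_derivative g (at x within Rd d) v = D v"
  using assms by (intro has_derivative_Rd_unique[of g _ x d])
    (auto simp: frechet_derivative_works[symmetric] differentiableI)

lemma nth_deriv_has_derivative:
  assumes "n_times_differentiable d n g" "length vs < n" "set vs \<subseteq> Rd d" "x \<in> Rd d"
  shows "((\<lambda>y. nth_deriv d g y vs) has_derivative (\<lambda>h. nth_deriv d g x (proj d h # vs)))
    (at x within Rd d)"
  unfolding nth_deriv.simps
  using assms by (intro has_derivative_proj)
    (auto simp: frechet_derivative_works[symmetric] n_times_differentiable_def differentiable_on_def)

text \<open>The head slot is linear because it is the argument of a derivative. For a deeper slot,
  the linearity identity, valid at every base point of \<open>Rd d\<close>, is differentiated in the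
  direction \<open>c\<close> of the head; uniqueness of derivatives transfers it.\<close>

lemma nth_deriv_linear:
  assumes "n_times_differentiable d n g" "length cs + length ds < n"
    "set cs \<subseteq> Rd d" "set ds \<subseteq> Rd d" "x \<in> Rd d"
  shows "linear (\<lambda>w. nth_deriv d g x (cs @ proj d w # ds))"
  using assms(2-)
proof (induction cs arbitrary: x)
  case Nil
  then show ?case
    using nth_deriv_has_derivative[OF assms(1), of ds x]
    by (auto dest: has_derivative_bounded_linear bounded_linear.linear)
next
  case (Cons c cs)
  let ?F = "\<lambda>w y. nth_deriv d g y (cs @ proj d w # ds)"
  have c: "c \<in> Rd d" "proj d c = c" using Cons.prems by auto
  have lin: "linear (\<lambda>w. ?F w y)" if "y \<in> Rd d" for y
    using Cons that by auto
  have der: "((?F w) has_derivative (\<lambda>h. nth_deriv d g x (proj d h # cs @ proj d w # ds)))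
      (at x within Rd d)" for w
    using Cons.prems by (intro nth_deriv_has_derivative[OF assms(1)]) auto
  have eq: "nth_deriv d g x ((c # cs) @ proj d w # ds) = D c"
    if "(?F w has_derivative D) (at x within Rd d)" for w D
    using frechet_derivative_Rd[OF that] Cons.prems by simp
  show ?case
  proof (rule linearI)
    fix w w'
    have "(?F (w + w') has_derivative (\<lambda>h. nth_deriv d g x (proj d h # cs @ proj d w # ds)
        + nth_deriv d g x (proj d h # cs @ proj d w' # ds))) (at x within Rd d)"
      by (rule has_derivative_transform[OF _ _ has_derivative_add[OF der der]])
        (use Cons.prems in \<open>auto simp: linear_add[OF lin]\<close>)
    from eq[OF this] show "nth_deriv d g x ((c # cs) @ proj d (w + w') # ds) =
      nth_deriv d g x ((c # cs) @ proj d w # ds) + nth_deriv d g x ((c # cs) @ proj d w' # ds)"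
      by (simp add: c)
  next
    fix r :: real and w
    have "(?F (r *\<^sub>R w) has_derivative (\<lambda>h. r *\<^sub>R nth_deriv d g x (proj d h # cs @ proj d w # ds)))
      (at x within Rd d)"
      by (rule has_derivative_transform[OF _ _ has_derivative_scaleR_right[OF der]])
        (use Cons.prems in \<open>auto simp: linear_scale[OF lin]\<close>)
    from eq[OF this] show "nth_deriv d g x ((c # cs) @ proj d (r *\<^sub>R w) # ds) =
      r *\<^sub>R nth_deriv d g x ((c # cs) @ proj d w # ds)"
      by (simp add: c)
  qed
qed

lemma linear_proj_expand:
  assumes "linear (\<lambda>w. A (proj d w))" "w \<in> Rd d"
  shows "A w = (\<Sum>b<d. coord w b *\<^sub>R A (unit_rseq b))"
proof -
  have "A w = A (proj d (\<Sum>b<d. coord w b *\<^sub>R unit_rseq b))"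
    by (simp add: Rd_eq_sum assms(2))
  also have "\<dots> = (\<Sum>b<d. coord w b *\<^sub>R A (proj d (unit_rseq b)))"
    by (simp only: linear_sum[OF assms(1)] linear_scale[OF assms(1)])
  finally show ?thesis by simp
qed

text \<open>Projecting a function with values in \<open>Rd d\<close> changes nothing, so by
  uniqueness its derivative equals its own projection.\<close>

lemma nth_deriv_in_Rd:
  assumes "n_times_differentiable d n g" "length vs \<le> n" "set vs \<subseteq> Rd d" "x \<in> Rd d" "g \<in> Rd d \<rightarrow> Rd d"
  shows "nth_deriv d g x vs \<in> Rd d"
  using assms(2-4)
proof (induction vs arbitrary: x)
  case (Cons v vs)
  note der = nth_deriv_has_derivative[OF assms(1), of vs x]
  have "((\<lambda>y. nth_deriv d g y vs) has_derivative
      (\<lambda>h. proj d (nth_deriv d g x (proj d h # vs)))) (at x within Rd d)"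
    by (rule has_derivative_transform[OF _ _ bounded_linear.has_derivative[OF bounded_linear_proj der]])
      (use Cons in auto)
  from has_derivative_Rd_unique[OF der this, of v]
  have "nth_deriv d g x (v # vs) = proj d (nth_deriv d g x (v # vs))"
    using Cons.prems by simp
  then show ?case by (metis proj_in_Rd)
qed (use assms in auto)

section \<open>Multilinear bounds, continuity and uniform differentiability\<close>

lemma op_norm_SUP_le_iff:
  assumes "0 \<le> C"
  shows "(SUP x\<in>S. op_norm d k (A x)) \<le> ennreal C \<longleftrightarrow>
    (\<forall>x\<in>S. \<forall>vs. length vs = k \<longrightarrow> (\<forall>v\<in>set vs. v \<in> Rd d \<and> norm v = 1) \<longrightarrow> norm (A x vs) \<le> C)"
  using assms by (auto simp: op_norm_def SUP_le_iff)

text \<open>Multilinearity lets the slots be normalised one at a time; \<open>cs\<close> holds the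
  unit vectors already reached. A zero vector cannot be normalised, but makes both sides
  vanish.\<close>

lemma nth_deriv_norm_le:
  assumes g: "n_times_differentiable d n g" "0 \<le> L" "k \<le> n" "x \<in> Rd d"
    and unit: "\<And>vs. length vs = k \<Longrightarrow> (\<forall>v\<in>set vs. v \<in> Rd d \<and> norm v = 1) \<Longrightarrow>
      norm (nth_deriv d g x vs) \<le> L"
    and vs: "length vs = k" "set vs \<subseteq> Rd d"
  shows "norm (nth_deriv d g x vs) \<le> L * prod_list (map norm vs)"
proof -
  have "norm (nth_deriv d g x (cs @ ds)) \<le> L * prod_list (map norm ds)"
    if "length (cs @ ds) = k" "set ds \<subseteq> Rd d" "\<forall>v\<in>set cs. v \<in> Rd d \<and> norm v = 1" for cs ds
    using that
  proof (induction ds arbitrary: cs)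
    case Nil
    then show ?case using unit by simp
  next
    case (Cons w ds)
    define u where "u = w /\<^sub>R norm w"
    have w: "w = norm w *\<^sub>R u" by (cases "w = 0") (simp_all add: u_def)
    have wR: "w \<in> Rd d" "u \<in> Rd d" using Cons.prems by (auto simp: u_def)
    have "linear (\<lambda>w. nth_deriv d g x (cs @ proj d w # ds))"
      using Cons.prems g by (intro nth_deriv_linear[of d n]) auto
    from linear_scale[OF this, of "norm w" u]
    have eq: "nth_deriv d g x (cs @ w # ds) = norm w *\<^sub>R nth_deriv d g x (cs @ u # ds)"
      using w wR by simp
    show ?case
    proof (cases "w = 0")
      case False
      then have "norm u = 1" by (simp add: u_def)
      then have "norm (nth_deriv d g x ((cs @ [u]) @ ds)) \<le> L * prod_list (map norm ds)"
        using Cons.prems wR by (intro Cons.IH) auto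
      from mult_left_mono[OF this norm_ge_zero[of w]] show ?thesis
        by (simp add: eq mult.left_commute)
    qed (use eq in simp)
  qed
  from this[of "[]" vs] show ?thesis using vs by simp
qed

lemma n_times_continuously_differentiable_imp_differentiable:
  "n_times_continuously_differentiable d n g \<Longrightarrow> n_times_differentiable d n g"
  by (simp add: n_times_continuously_differentiable_def)

lemma nth_deriv_continuous_on:
  assumes "n_times_continuously_differentiable d n g" "length vs \<le> n" "set vs \<subseteq> Rd d"
  shows "continuous_on (Rd d) (\<lambda>x. nth_deriv d g x vs)"
  using assms by (cases "length vs = n")
    (auto simp: n_times_continuously_differentiable_def n_times_differentiable_def
      intro!: differentiable_imp_continuous_on)

lemma n_times_continuously_differentiable_mono:
  assumes "n_times_continuously_differentiable d n g" "k \<le> n"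
  shows "n_times_continuously_differentiable d k g"
  using assms nth_deriv_continuous_on[OF assms(1)]
  by (auto simp: n_times_continuously_differentiable_def n_times_differentiable_def)

text \<open>A moving direction is expanded in the unit vectors: continuous coefficients times values
  with one more constant slot. The constant slots accumulate in \<open>cs\<close>.\<close>

lemma nth_deriv_continuous_slots:
  assumes g: "n_times_continuously_differentiable d n g"
    and u: "continuous_on S u" "\<And>t. t \<in> S \<Longrightarrow> u t \<in> Rd d"
    and "\<And>w. w \<in> set ws \<Longrightarrow> continuous_on S w" "\<And>w t. w \<in> set ws \<Longrightarrow> t \<in> S \<Longrightarrow> w t \<in> Rd d"
    and "length cs + length ws \<le> n" "set cs \<subseteq> Rd d"
  shows "continuous_on S (\<lambda>t. nth_deriv d g (u t) (cs @ map (\<lambda>w. w t) ws))"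
  using assms(4-)
proof (induction ws arbitrary: cs)
  case Nil
  then show ?case
    using u by (auto intro!: continuous_on_compose2[OF nth_deriv_continuous_on[OF g]])
next
  case (Cons w ws)
  have "continuous_on S (\<lambda>t. \<Sum>b<d. coord (w t) b *\<^sub>R
      nth_deriv d g (u t) ((cs @ [unit_rseq b]) @ map (\<lambda>w. w t) ws))"
    using Cons.prems
    by (intro continuous_intros bounded_linear.continuous_on[OF bounded_linear_coord] Cons.IH) auto
  moreover have "nth_deriv d g (u t) (cs @ map (\<lambda>w. w t) (w # ws)) = (\<Sum>b<d. coord (w t) b *\<^sub>R
      nth_deriv d g (u t) ((cs @ [unit_rseq b]) @ map (\<lambda>w. w t) ws))" if "t \<in> S" for t
    using Cons.prems u that
      linear_proj_expand[OF nth_deriv_linear[OF n_times_continuously_differentiable_imp_differentiable[OF g]],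
        of cs "map (\<lambda>w. w t) ws" "u t" "w t"] by auto
  ultimately show ?case by (simp cong: continuous_on_cong_simp)
qed

text \<open>Each point of \<open>K\<close> has a ball on which the partial derivatives oscillate by
  less than \<open>\<eta>\<close>. A Lebesgue number of this cover is a radius valid on all of
  \<open>K\<close>, and the mean value inequality on the segment from \<open>p\<close> to
  \<open>q\<close> gives the expansion.\<close>

lemma uniformly_differentiable_on_compact:
  assumes K: "compact K" "K \<subseteq> Rd d"
    and g: "\<And>y. y \<in> Rd d \<Longrightarrow> (g has_derivative (\<lambda>h. g' y (proj d h))) (at y within Rd d)"
    and cont: "\<And>v. v \<in> Rd d \<Longrightarrow> continuous_on (Rd d) (\<lambda>y. g' y v)"
    and \<epsilon>: "0 < \<epsilon>"
  shows "\<exists>\<delta>>0. \<forall>p\<in>K. \<forall>q\<in>Rd d. norm (q - p) < \<delta> \<longrightarrow>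
    norm (g q - g p - g' p (q - p)) \<le> \<epsilon> * norm (q - p)"
proof -
  \<comment> \<open>The \<open>d\<close> partial derivatives together contribute
    \<open>d * \<eta>\<close>; the denominator \<open>d + 1\<close> covers
    \<open>d = 0\<close>.\<close>
  define \<eta> where "\<eta> = \<epsilon> / (d + 1)"
  have \<eta>: "0 < \<eta>" "d * \<eta> \<le> \<epsilon>"
    using \<epsilon> by (auto simp: \<eta>_def field_simps)
  define \<G> where "\<G> = {G. open G \<and> (\<forall>b<d. \<forall>y\<in>G \<inter> Rd d. \<forall>z\<in>G \<inter> Rd d.
    norm (g' y (unit_rseq b) - g' z (unit_rseq b)) < \<eta>)}"
  have "K \<subseteq> \<Union>\<G>"
  proof
    fix p assume "p \<in> K"
    then have p: "p \<in> Rd d" using K by auto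
    have "\<exists>r>0. \<forall>y\<in>Rd d. norm (y - p) < r \<longrightarrow>
        norm (g' y (unit_rseq b) - g' p (unit_rseq b)) < \<eta> / 2" if "b < d" for b
      using cont[of "unit_rseq b"] that p \<eta>(1)
      unfolding continuous_on_iff dist_norm by (metis Rd_closed_ops(6) half_gt_zero)
    then obtain r where r: "\<And>b. b < d \<Longrightarrow> 0 < r b"
      "\<And>b y. b < d \<Longrightarrow> y \<in> Rd d \<Longrightarrow> norm (y - p) < r b \<Longrightarrow>
        norm (g' y (unit_rseq b) - g' p (unit_rseq b)) < \<eta> / 2"
      by metis
    define \<rho> where "\<rho> = Min (insert 1 (r ` {..<d}))"
    have \<rho>: "0 < \<rho>" "\<And>b. b < d \<Longrightarrow> \<rho> \<le> r b"
      using r(1) by (auto simp: \<rho>_def)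
    have "ball p \<rho> \<in> \<G>"
      unfolding \<G>_def
    proof (intro CollectI conjI allI impI ballI)
      fix b y z assume b: "b < d" and yz: "y \<in> ball p \<rho> \<inter> Rd d" "z \<in> ball p \<rho> \<inter> Rd d"
      have "norm (y' - p) < r b" if "y' \<in> ball p \<rho>" for y'
        using that \<rho>(2)[OF b] by (simp add: dist_norm norm_minus_commute)
      with b yz have "norm (g' y (unit_rseq b) - g' p (unit_rseq b)) < \<eta> / 2"
        "norm (g' z (unit_rseq b) - g' p (unit_rseq b)) < \<eta> / 2"
        by (intro r(2); blast)+
      then show "norm (g' y (unit_rseq b) - g' z (unit_rseq b)) < \<eta>"
        by (rule norm_triangle_half_l)
    qed simp
    then show "p \<in> \<Union>\<G>" using \<rho>(1) centre_in_ball by blast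
  qed
  then obtain \<delta> where \<delta>: "0 < \<delta>" "\<And>p. p \<in> K \<Longrightarrow> \<exists>G\<in>\<G>. ball p \<delta> \<subseteq> G"
    by (rule Heine_Borel_lemma[OF K(1)]) (simp_all add: \<G>_def)
  have "norm (g q - g p - g' p (q - p)) \<le> \<epsilon> * norm (q - p)"
    if p: "p \<in> K" and q: "q \<in> Rd d" "norm (q - p) < \<delta>" for p q
  proof -
    have pR: "p \<in> Rd d" using p K by auto
    obtain G where G: "G \<in> \<G>" "ball p \<delta> \<subseteq> G" using \<delta>(2)[OF p] by auto
    define S where "S = G \<inter> Rd d \<inter> ball p \<delta>"
    have pS: "p \<in> S" using pR G \<delta>(1) by (auto simp: S_def)
    have lin: "linear (\<lambda>h. g' y (proj d h))" if "y \<in> Rd d" for y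
      using g[OF that] by (auto dest: has_derivative_bounded_linear bounded_linear.linear)
    have "norm (g q - g p - (\<lambda>h. g' p (proj d h)) (q - p)) \<le> norm (q - p) * \<epsilon>"
    proof (rule differentiable_bound_linearization[where S = S and f' = "\<lambda>y h. g' y (proj d h)"])
      fix t :: real assume "t \<in> {0..1}"
      moreover have "norm (t *\<^sub>R (q - p)) \<le> norm (q - p)" if "0 \<le> t" "t \<le> 1"
        using that by (simp add: mult_left_le_one_le)
      ultimately show "p + t *\<^sub>R (q - p) \<in> S"
        using pR q G by (auto simp: S_def dist_norm)
    next
      fix y assume "y \<in> S"
      then show "(g has_derivative (\<lambda>h. g' y (proj d h))) (at y within S)"
        by (intro has_derivative_subset[OF g]) (auto simp: S_def)
    next
      fix y assume y: "y \<in> S"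
      have yR: "y \<in> Rd d" using y by (auto simp: S_def)
      show "onorm ((\<lambda>h. g' y (proj d h)) - (\<lambda>h. g' p (proj d h))) \<le> \<epsilon>"
      proof (rule onorm_bound)
        fix h
        have *: "g' z (proj d h) = (\<Sum>b<d. coord (proj d h) b *\<^sub>R g' z (unit_rseq b))"
          if "z \<in> Rd d" for z
          by (rule linear_proj_expand[OF lin[OF that]]) simp
        have "norm (((\<lambda>h. g' y (proj d h)) - (\<lambda>h. g' p (proj d h))) h)
            = norm (\<Sum>b<d. coord (proj d h) b *\<^sub>R (g' y (unit_rseq b) - g' p (unit_rseq b)))"
          by (simp add: * yR pR sum_subtractf scaleR_diff_right)
        also have "\<dots> \<le> (\<Sum>b<d. norm h * \<eta>)"
        proof (rule sum_norm_le)
          fix b assume "b \<in> {..<d}"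
          moreover have "\<bar>coord (proj d h) b\<bar> \<le> norm h"
            using abs_coord_le[of "proj d h" b] norm_proj_le[of d h] by simp
          ultimately show "norm (coord (proj d h) b *\<^sub>R (g' y (unit_rseq b) - g' p (unit_rseq b)))
              \<le> norm h * \<eta>"
            using G(1) y pS \<eta>(1) unfolding norm_scaleR
            by (intro mult_mono) (auto simp: \<G>_def S_def intro: less_imp_le)
        qed
        also have "\<dots> \<le> \<epsilon> * norm h"
          using mult_right_mono[OF \<eta>(2) norm_ge_zero[of h]] by (simp add: algebra_simps)
        finally show "norm (((\<lambda>h. g' y (proj d h)) - (\<lambda>h. g' p (proj d h))) h) \<le> \<epsilon> * norm h" .
      qed (use \<epsilon> in simp)
    qed (rule pS)
    then show ?thesis using pR q by (simp add: mult.commute)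
  qed
  then show ?thesis using \<delta>(1) by blast
qed

subsection \<open>Global solutions of Lipschitz ordinary differential equations\<close>

text \<open>Serves as the integral in Picard iteration, built from real antiderivatives of the
  finitely many coordinates.\<close>

lemma antiderivative_Rd:
  assumes "continuous_on UNIV \<phi>" "\<And>t. \<phi> t \<in> Rd d"
  shows "\<exists>\<Phi>. \<Phi> 0 = 0 \<and> (\<forall>t::real. \<Phi> t \<in> Rd d \<and> (\<Phi> has_vector_derivative \<phi> t) (at t))"
proof -
  have "\<exists>F. \<forall>t. (F has_vector_derivative coord (\<phi> t) b) (at t)" for b
  proof -
    have "isCont (\<lambda>t. coord (\<phi> t) b) t" for t
      using bounded_linear.continuous_on[OF bounded_linear_coord assms(1)]
      by (simp add: continuous_on_eq_continuous_at)
    then show ?thesis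
      using einterval_antiderivative[of "-\<infinity>" \<infinity> "\<lambda>t. coord (\<phi> t) b"] by simp
  qed
  then obtain F where F: "\<And>b t. (F b has_vector_derivative coord (\<phi> t) b) (at t)"
    by metis
  define \<Phi> where "\<Phi> t = (\<Sum>b<d. (F b t - F b 0) *\<^sub>R unit_rseq b)" for t
  have "(\<Phi> has_vector_derivative (\<Sum>b<d. coord (\<phi> t) b *\<^sub>R unit_rseq b)) (at t)" for t
    using F[of _ t] unfolding \<Phi>_def has_real_derivative_iff_has_vector_derivative[symmetric]
    by (auto intro!: derivative_eq_intros)
  moreover have "\<Phi> 0 = 0" "\<Phi> t \<in> Rd d" for t
    by (auto simp: \<Phi>_def)
  ultimately show ?thesis using assms(2) by (auto simp: Rd_eq_sum)
qed

lemma vector_derivative_reflect: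
  assumes "(\<Phi> has_vector_derivative D) (at (- t))"
  shows "((\<lambda>s. \<Phi> (- s)) has_vector_derivative (- D)) (at (t::real))"
proof -
  have "(uminus has_vector_derivative - 1) (at t)"
    by (auto intro!: derivative_eq_intros)
  from vector_diff_chain_at[OF this, of \<Phi> D] assms show ?thesis
    by (simp add: o_def)
qed

lemma norm_le_of_derivative_bound:
  fixes \<Phi> :: "real \<Rightarrow> 'a::real_normed_vector"
  assumes \<Phi>: "\<Phi> 0 = 0" "\<And>t. (\<Phi> has_vector_derivative \<phi> t) (at t)"
    and \<psi>: "\<And>t. (\<psi> has_real_derivative \<psi>' t) (at t)" "0 \<le> \<psi> 0"
    and le: "\<And>t. \<bar>t\<bar> \<le> T \<Longrightarrow> norm (\<phi> t) \<le> \<psi>' \<bar>t\<bar>"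
    and t: "\<bar>t\<bar> \<le> T"
  shows "norm (\<Phi> t) \<le> \<psi> \<bar>t\<bar>"
proof -
  have pos: "norm (\<Theta> t) \<le> \<psi> t"
    if \<Theta>: "\<Theta> 0 = 0" "\<And>t. (\<Theta> has_vector_derivative \<theta> t) (at t)" "\<And>s. 0 \<le> s \<Longrightarrow> s \<le> T \<Longrightarrow> norm (\<theta> s) \<le> \<psi>' s"
      and "0 \<le> t" "t \<le> T" for \<Theta> :: "real \<Rightarrow> 'a" and \<theta> t
  proof (cases "t = 0")
    case False
    have "continuous_on {0..t} \<Theta>"
      by (rule continuous_on_vector_derivative[of _ _ \<theta>]) (use \<Theta>(2) has_vector_derivative_at_within in blast)
    moreover have "continuous_on {0..t} \<psi>"
      by (rule DERIV_continuous_on[of _ _ \<psi>']) (use \<psi>(1) has_field_derivative_at_within in blast)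
    ultimately have "norm (\<Theta> t - \<Theta> 0) \<le> \<psi> t - \<psi> 0"
      using False that \<psi> by (intro differentiable_bound_general[of 0 t \<Theta> \<psi> \<theta> \<psi>'])
        (auto simp: has_real_derivative_iff_has_vector_derivative)
    then show ?thesis using \<psi>(2) \<Theta>(1) by simp
  qed (use \<psi> \<Theta> in simp)
  show ?thesis
  proof (cases "0 \<le> t")
    case True
    have "norm (\<phi> s) \<le> \<psi>' s" if "0 \<le> s" "s \<le> T" for s
      using le[of s] that by simp
    then show ?thesis using pos[of \<Phi> \<phi> t] \<Phi> True t by simp
  next
    case False
    have "norm (- \<phi> (- s)) \<le> \<psi>' s" if "0 \<le> s" "s \<le> T" for s
      using le[of "- s"] that by simp
    then show ?thesis
      using pos[of "\<lambda>s. \<Phi> (- s)" "\<lambda>s. - \<phi> (- s)" "- t"] \<Phi>(1)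
        vector_derivative_reflect[OF \<Phi>(2)] False t by simp
  qed
qed

text \<open>With distances weighted by \<open>exp (- 2 * L * \<bar>t\<bar>)\<close>, the Picard map
  contracts by the factor 1/2 on every interval [-T, T]. The iterates thus converge on the whole
  time axis, and no local solutions have to be glued.\<close>

lemma lipschitz_ode_exists:
  fixes F :: "real \<Rightarrow> rseq \<Rightarrow> rseq"
  assumes x: "x \<in> Rd d" and L: "0 < L"
    and F: "\<And>t y. y \<in> Rd d \<Longrightarrow> F t y \<in> Rd d"
    and cont: "\<And>u. continuous_on UNIV u \<Longrightarrow> (\<And>t. u t \<in> Rd d) \<Longrightarrow> continuous_on UNIV (\<lambda>t. F t (u t))"
    and lip: "\<And>t y z. y \<in> Rd d \<Longrightarrow> z \<in> Rd d \<Longrightarrow> norm (F t y - F t z) \<le> L * norm (y - z)"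
  shows "\<exists>u. u 0 = x \<and> (\<forall>t. u t \<in> Rd d \<and> (u has_vector_derivative F t (u t)) (at t))"
proof -
  define good where "good u \<longleftrightarrow> continuous_on UNIV u \<and> (\<forall>t. u t \<in> Rd d)" for u :: "real \<Rightarrow> rseq"
  \<comment> \<open>Stands for the integral of \<open>\<phi>\<close> from 0; meaningful for
    continuous \<open>\<phi>\<close> with values in \<open>Rd d\<close>.\<close>
  define A where "A \<phi> = (SOME \<Phi>. \<Phi> 0 = 0 \<and> (\<forall>t::real. \<Phi> t \<in> Rd d \<and> (\<Phi> has_vector_derivative \<phi> t) (at t)))" for \<phi>
  define \<Gamma> where "\<Gamma> u t = x + A (\<lambda>t. F t (u t)) t" for u t
  have A: "A (\<lambda>t. F t (u t)) 0 = 0" "A (\<lambda>t. F t (u t)) t \<in> Rd d"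
    "(A (\<lambda>t. F t (u t)) has_vector_derivative F t (u t)) (at t)" if "good u" for u t
    using someI_ex[OF antiderivative_Rd[of "\<lambda>t. F t (u t)" d], folded A_def] that cont F
    unfolding good_def by auto
  have \<Gamma>': "(\<Gamma> u has_vector_derivative F t (u t)) (at t)" if "good u" for u t
    unfolding \<Gamma>_def using A(3)[OF that] by (auto intro!: derivative_eq_intros)
  have good_\<Gamma>: "good (\<Gamma> u)" if "good u" for u
    unfolding good_def
  proof
    show "continuous_on UNIV (\<Gamma> u)"
      by (rule continuous_on_vector_derivative[OF \<Gamma>'[OF that]])
    show "\<forall>t. \<Gamma> u t \<in> Rd d" using A(2)[OF that] x by (simp add: \<Gamma>_def)
  qed
  \<comment> \<open>Integrating \<open>L * B * exp (2 * L * s)\<close> from 0 to \<open>t\<close>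
    gives at most \<open>B / 2 * exp (2 * L * t)\<close>: the rate \<open>2 * L\<close> of the
    weight produces the factor 1/2.\<close>
  have \<Gamma>_bound: "norm (\<Gamma> u t - \<Gamma> w t) \<le> B / 2 * exp (2 * L * \<bar>t\<bar>)"
    if good: "good u" "good w" and B: "0 \<le> B"
      and le: "\<And>t. \<bar>t\<bar> \<le> T \<Longrightarrow> norm (u t - w t) \<le> B * exp (2 * L * \<bar>t\<bar>)" and t: "\<bar>t\<bar> \<le> T" for u w B T t
  proof (rule norm_le_of_derivative_bound[where T = T])
    show "\<Gamma> u 0 - \<Gamma> w 0 = 0" by (simp add: \<Gamma>_def A good)
    show "((\<lambda>t. \<Gamma> u t - \<Gamma> w t) has_vector_derivative F t (u t) - F t (w t)) (at t)" for t
      by (intro derivative_intros \<Gamma>' good)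
    show "((\<lambda>t. B / 2 * exp (2 * L * t)) has_real_derivative L * (B * exp (2 * L * t))) (at t)" for t
      by (auto intro!: derivative_eq_intros)
    show "norm (F t (u t) - F t (w t)) \<le> L * (B * exp (2 * L * \<bar>t\<bar>))" if "\<bar>t\<bar> \<le> T" for t
      using lip[of "u t" "w t" t] mult_left_mono[OF le[OF that], of L] L good
      unfolding good_def by (meson less_imp_le order.trans)
  qed (use B t in auto)
  define U where "U n = (\<Gamma> ^^ n) (\<lambda>_. x)" for n
  have good_U: "good (U n)" for n
  proof (induction n)
    case 0
    show ?case using x by (simp add: U_def good_def)
  next
    case (Suc n)
    then show ?case using good_\<Gamma> by (simp add: U_def)
  qed
  have U_Suc: "U (Suc n) = \<Gamma> (U n)" for n by (simp add: U_def)
  \<comment> \<open>Compactness bounds the first Picard step, halving gives the geometric rate, and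
    the weight is absorbed into \<open>B\<close>.\<close>
  have "\<exists>B\<ge>0. \<forall>n t. \<bar>t\<bar> \<le> T \<longrightarrow> norm (U (Suc n) t - U n t) \<le> B / 2 ^ n" for T
  proof -
    have "compact ((\<lambda>t. U 1 t - U 0 t) ` {-T..T})"
      using good_U[of 0] good_U[of 1] unfolding good_def
      by (intro compact_continuous_image continuous_intros)
        (auto intro: continuous_on_subset)
    from compact_imp_bounded[OF this] obtain B where B: "0 < B" "\<And>t. \<bar>t\<bar> \<le> T \<Longrightarrow> norm (U 1 t - U 0 t) \<le> B"
      by (auto simp: bounded_pos abs_le_iff)
    have "norm (U (Suc n) t - U n t) \<le> B / 2 ^ n * exp (2 * L * \<bar>t\<bar>)" if "\<bar>t\<bar> \<le> T" for n t
      using that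
    proof (induction n arbitrary: t)
      case 0
      have "B * 1 \<le> B * exp (2 * L * \<bar>t\<bar>)"
        using B(1) L by (intro mult_left_mono) auto
      then show ?case using B(2)[OF 0] by simp
    next
      case (Suc n)
      show ?case
        using \<Gamma>_bound[OF good_U good_U _ Suc.IH Suc.prems] B(1) by (simp add: U_Suc)
    qed
    moreover have "B / 2 ^ n * exp (2 * L * \<bar>t\<bar>) \<le> B * exp (2 * L * T) / 2 ^ n" if "\<bar>t\<bar> \<le> T" for n t
      using that B(1) L by (simp add: divide_right_mono)
    ultimately show ?thesis
      using B(1) by (intro exI[of _ "B * exp (2 * L * T)"] conjI allI impI, simp) (meson order.trans)
  qed
  then obtain B where B: "\<And>T. 0 \<le> B T"
    "\<And>T n t. \<bar>t\<bar> \<le> T \<Longrightarrow> norm (U (Suc n) t - U n t) \<le> B T / 2 ^ n"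
    by metis
  have U_Rd: "U n t \<in> Rd d" for n t using good_U by (simp add: good_def)
  have "\<exists>l\<in>Rd d. \<forall>n. norm (l - U n t) \<le> 2 * B \<bar>t\<bar> / 2 ^ n" for t
    by (rule geometric_sequence_converges_Rd[OF U_Rd B(2)[OF order_refl]])
  then obtain u where u: "\<And>t. u t \<in> Rd d" "\<And>t n. norm (u t - U n t) \<le> 2 * B \<bar>t\<bar> / 2 ^ n"
    by metis
  have lim0: "(\<lambda>n. C / 2 ^ n) \<longlonglongrightarrow> 0" for C :: real
    using tendsto_mult[OF tendsto_const[of C] LIMSEQ_power_zero[of "1/2 :: real"]]
    by (simp add: power_one_over field_simps)
  have lim: "(\<lambda>n. U n t) \<longlonglongrightarrow> u t" for t
    by (rule LIM_zero_cancel, rule Lim_null_comparison[OF _ lim0[of "2 * B \<bar>t\<bar>"]])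
      (simp add: norm_minus_commute u(2))
  \<comment> \<open>The bound obtained together with \<open>u\<close> involves
    \<open>B \<bar>t\<bar>\<close>, which varies with \<open>t\<close> in an unknown way. Uniqueness
    of limits replaces it by a single \<open>B T\<close> on [-T, T].\<close>
  have unif: "norm (u t - U n t) \<le> 2 * B T / 2 ^ n" if t: "\<bar>t\<bar> \<le> T" for T t n
  proof -
    obtain l where "\<And>n. norm (l - U n t) \<le> 2 * B T / 2 ^ n"
      using geometric_sequence_converges_Rd[of "\<lambda>n. U n t", OF U_Rd B(2)[OF t]] by blast
    moreover from this have "(\<lambda>n. U n t) \<longlonglongrightarrow> l"
      by (intro LIM_zero_cancel[OF Lim_null_comparison[OF _ lim0[of "2 * B T"]]])
        (simp add: norm_minus_commute)
    ultimately show ?thesis using LIMSEQ_unique[OF lim[of t], of l] by simp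
  qed
  have "isCont u t" for t
  proof -
    \<comment> \<open>The margin 1 puts \<open>t\<close> into the interior of the interval.\<close>
    have "uniform_limit {-(\<bar>t\<bar>+1)..\<bar>t\<bar>+1} U u sequentially"
      unfolding uniform_limit_sequentially_iff dist_norm
    proof (intro allI impI)
      fix e :: real assume "0 < e"
      from order_tendstoD(2)[OF lim0 this, of "2 * B (\<bar>t\<bar>+1)"] obtain N where N: "\<And>n. n \<ge> N \<Longrightarrow> 2 * B (\<bar>t\<bar>+1) / 2 ^ n < e"
        unfolding eventually_sequentially by blast
      have "norm (U n s - u s) < e" if "N \<le> n" "s \<in> {-(\<bar>t\<bar>+1)..\<bar>t\<bar>+1}" for n s
      proof -
        have "\<bar>s\<bar> \<le> \<bar>t\<bar> + 1" using that(2) by (auto simp: abs_le_iff)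
        from unif[OF this, of n] N[OF that(1)] show ?thesis by (simp add: norm_minus_commute)
      qed
      then show "\<exists>N. \<forall>n\<ge>N. \<forall>s\<in>{-(\<bar>t\<bar>+1)..\<bar>t\<bar>+1}. norm (U n s - u s) < e" by blast
    qed
    moreover have "continuous_on {-(\<bar>t\<bar>+1)..\<bar>t\<bar>+1} (U n)" for n
      by (rule continuous_on_subset[OF _ subset_UNIV]) (use good_U in \<open>simp add: good_def\<close>)
    ultimately have "continuous_on {-(\<bar>t\<bar>+1)..\<bar>t\<bar>+1} u"
      by (intro uniform_limit_theorem[OF always_eventually _ sequentially_bot]) auto
    then show ?thesis
      by (rule continuous_on_interior) (auto simp: interior_atLeastAtMost_real)
  qed
  then have good_u: "good u"
    using u(1) by (simp add: good_def continuous_at_imp_continuous_on)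
  \<comment> \<open>\<open>U (Suc n) t\<close> tends to \<open>u t\<close>, and also to
    \<open>\<Gamma> u t\<close> by the contraction estimate.\<close>
  have "\<Gamma> u t = u t" for t
  proof (rule LIMSEQ_unique[of "\<lambda>n. U (Suc n) t"])
    show "(\<lambda>n. U (Suc n) t) \<longlonglongrightarrow> u t" by (rule LIMSEQ_Suc[OF lim])
    have "norm (U (Suc n) t - \<Gamma> u t) \<le> (B \<bar>t\<bar> * exp (2 * L * \<bar>t\<bar>)) / 2 ^ n" for n
    proof -
      have "norm (U n s - u s) \<le> 2 * B \<bar>t\<bar> / 2 ^ n * exp (2 * L * \<bar>s\<bar>)" if "\<bar>s\<bar> \<le> \<bar>t\<bar>" for s
      proof -
        have "2 * B \<bar>t\<bar> / 2 ^ n * 1 \<le> 2 * B \<bar>t\<bar> / 2 ^ n * exp (2 * L * \<bar>s\<bar>)"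
          using B(1)[of "\<bar>t\<bar>"] L by (intro mult_left_mono) auto
        then show ?thesis using unif[OF that, of n] by (simp add: norm_minus_commute)
      qed
      from \<Gamma>_bound[OF good_U good_u _ this order_refl] B(1)[of "\<bar>t\<bar>"]
      show ?thesis by (simp add: U_Suc)
    qed
    then show "(\<lambda>n. U (Suc n) t) \<longlonglongrightarrow> \<Gamma> u t"
      by (intro LIM_zero_cancel[OF Lim_null_comparison[OF _ lim0[of "B \<bar>t\<bar> * exp (2 * L * \<bar>t\<bar>)"]]]) auto
  qed
  then have fixpoint: "\<Gamma> u = u" by auto
  have "\<Gamma> u 0 = x" by (simp add: \<Gamma>_def A(1)[OF good_u])
  then show ?thesis
    using \<Gamma>'[OF good_u] u(1) unfolding fixpoint by blast
qed

subsection \<open>Derivatives that are uniform in time\<close>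

text \<open>Frechet differentiability at \<open>x\<close> as a map into the bounded functions on
  \<open>{0..T}\<close> with the supremum norm. Gronwall's inequality needs an error that is small
  at all times at once. The bounds on value and derivative are included because the product rule
  uses them uniformly in time.\<close>

definition unif_deriv ::
  "nat \<Rightarrow> real \<Rightarrow> (rseq \<Rightarrow> real \<Rightarrow> 'a::real_normed_vector) \<Rightarrow> (real \<Rightarrow> rseq \<Rightarrow> 'a) \<Rightarrow> rseq \<Rightarrow> bool"
  where "unif_deriv d T \<phi> \<phi>' x \<longleftrightarrow>
    (\<forall>t\<in>{0..T}. linear (\<phi>' t)) \<and>
    (\<exists>K. \<forall>t\<in>{0..T}. norm (\<phi> x t) \<le> K \<and> (\<forall>h. norm (\<phi>' t h) \<le> K * norm h)) \<and>
    (\<forall>\<epsilon>>0. \<forall>\<^sub>F y in at x within Rd d. \<forall>t\<in>{0..T}.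
      norm (\<phi> y t - \<phi> x t - \<phi>' t (y - x)) \<le> \<epsilon> * norm (y - x))"

lemma eventually_norm_less: "0 < \<delta> \<Longrightarrow> \<forall>\<^sub>F y in at x within S. norm (y - x) < \<delta>"
  for x :: "'a::real_normed_vector"
  by (auto simp: eventually_at dist_norm)

lemma eventually_within_mem: "\<forall>\<^sub>F y in at x within S. y \<in> S"
  by (auto simp: eventually_at_filter)

lemma unif_deriv_bound:
  assumes "unif_deriv d T \<phi> \<phi>' x"
  obtains K where "0 < K" "\<And>t. t \<in> {0..T} \<Longrightarrow> norm (\<phi> x t) \<le> K"
    "\<And>t h. t \<in> {0..T} \<Longrightarrow> norm (\<phi>' t h) \<le> K * norm h"
proof -
  obtain K where K: "\<And>t. t \<in> {0..T} \<Longrightarrow> norm (\<phi> x t) \<le> K"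
    "\<And>t h. t \<in> {0..T} \<Longrightarrow> norm (\<phi>' t h) \<le> K * norm h"
    using assms unfolding unif_deriv_def by blast
  have "K * norm h \<le> max 1 K * norm h" for h :: rseq
    by (intro mult_right_mono) auto
  then show ?thesis
    using K by (intro that[of "max 1 K"], simp, meson max.cobounded2 order.trans, meson order.trans)
qed

lemma unif_deriv_linear: "unif_deriv d T \<phi> \<phi>' x \<Longrightarrow> t \<in> {0..T} \<Longrightarrow> linear (\<phi>' t)"
  by (simp add: unif_deriv_def)

lemma unif_deriv_eventually:
  "unif_deriv d T \<phi> \<phi>' x \<Longrightarrow> 0 < \<epsilon> \<Longrightarrow> \<forall>\<^sub>F y in at x within Rd d. \<forall>t\<in>{0..T}.
      norm (\<phi> y t - \<phi> x t - \<phi>' t (y - x)) \<le> \<epsilon> * norm (y - x)"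
  by (simp add: unif_deriv_def)

lemma unif_derivI:
  assumes "\<And>t. t \<in> {0..T} \<Longrightarrow> linear (\<phi>' t)"
    "\<And>t. t \<in> {0..T} \<Longrightarrow> norm (\<phi> x t) \<le> K"
    "\<And>t h. t \<in> {0..T} \<Longrightarrow> norm (\<phi>' t h) \<le> K' * norm h"
    "\<And>\<epsilon>. 0 < \<epsilon> \<Longrightarrow> \<forall>\<^sub>F y in at x within Rd d. \<forall>t\<in>{0..T}.
      norm (\<phi> y t - \<phi> x t - \<phi>' t (y - x)) \<le> \<epsilon> * norm (y - x)"
  shows "unif_deriv d T \<phi> \<phi>' x"
proof -
  have "K' * norm h \<le> max K K' * norm h" for h :: rseq
    by (intro mult_right_mono) auto
  then have "\<forall>t\<in>{0..T}. norm (\<phi> x t) \<le> max K K' \<and> (\<forall>h. norm (\<phi>' t h) \<le> max K K' * norm h)"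
    using assms(2,3) by (meson max.cobounded1 order.trans)
  then show ?thesis using assms by (auto simp: unif_deriv_def)
qed

lemma unif_deriv_has_derivative:
  assumes "unif_deriv d T \<phi> \<phi>' x" "t \<in> {0..T}"
  shows "((\<lambda>y. \<phi> y t) has_derivative \<phi>' t) (at x within Rd d)"
proof -
  obtain K where "\<And>h. norm (\<phi>' t h) \<le> K * norm h"
    using unif_deriv_bound[OF assms(1)] assms(2) by metis
  then have "bounded_linear (\<phi>' t)"
    using unif_deriv_linear[OF assms]
    by (intro bounded_linear_intro[of _ K]) (auto simp: linear_add linear_scale mult.commute)
  moreover have "\<forall>\<^sub>F y in at x within Rd d. norm (\<phi> y t - \<phi> x t - \<phi>' t (y - x)) \<le> \<epsilon> * norm (y - x)"
    if "0 < \<epsilon>" for \<epsilon>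
    using unif_deriv_eventually[OF assms(1) that] by eventually_elim (use assms(2) in auto)
  ultimately show ?thesis by (auto simp: has_derivative_within_alt2)
qed

lemma unif_deriv_cong:
  assumes "unif_deriv d T \<phi> \<phi>' x" "x \<in> Rd d"
    "\<And>y t. y \<in> Rd d \<Longrightarrow> t \<in> {0..T} \<Longrightarrow> \<psi> y t = \<phi> y t"
    "\<And>t h. t \<in> {0..T} \<Longrightarrow> \<psi>' t h = \<phi>' t h"
  shows "unif_deriv d T \<psi> \<psi>' x"
proof -
  have eq: "\<psi>' t = \<phi>' t" if "t \<in> {0..T}" for t using assms(4)[OF that] by auto
  have "\<forall>\<^sub>F y in at x within Rd d. \<forall>t\<in>{0..T}.
      norm (\<psi> y t - \<psi> x t - \<psi>' t (y - x)) \<le> \<epsilon> * norm (y - x)" if "0 < \<epsilon>" for \<epsilon>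
    using unif_deriv_eventually[OF assms(1) that] eventually_within_mem[of "Rd d" x]
    by eventually_elim (use assms in auto)
  then show ?thesis using assms eq by (auto simp: unif_deriv_def)
qed

lemma unif_deriv_zero: "unif_deriv d T (\<lambda>x t. 0) (\<lambda>t h. 0) x"
  by (rule unif_derivI[of _ _ _ _ 0 0]) (auto simp: linear_zero)

lemma unif_deriv_add:
  assumes "unif_deriv d T \<phi> \<phi>' x" "unif_deriv d T \<psi> \<psi>' x"
  shows "unif_deriv d T (\<lambda>x t. \<phi> x t + \<psi> x t) (\<lambda>t h. \<phi>' t h + \<psi>' t h) x"
proof -
  obtain K where K: "\<And>t. t \<in> {0..T} \<Longrightarrow> norm (\<phi> x t) \<le> K"
    "\<And>t h. t \<in> {0..T} \<Longrightarrow> norm (\<phi>' t h) \<le> K * norm h"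
    using unif_deriv_bound[OF assms(1)] by metis
  obtain M where M: "\<And>t. t \<in> {0..T} \<Longrightarrow> norm (\<psi> x t) \<le> M"
    "\<And>t h. t \<in> {0..T} \<Longrightarrow> norm (\<psi>' t h) \<le> M * norm h"
    using unif_deriv_bound[OF assms(2)] by metis
  show ?thesis
  proof (rule unif_derivI[where K = "K + M" and K' = "K + M"])
    fix \<epsilon> :: real assume "0 < \<epsilon>"
    then have "0 < \<epsilon> / 2" by simp
    from unif_deriv_eventually[OF assms(1) this] unif_deriv_eventually[OF assms(2) this]
    show "\<forall>\<^sub>F y in at x within Rd d. \<forall>t\<in>{0..T}. norm (\<phi> y t + \<psi> y t - (\<phi> x t + \<psi> x t)
        - (\<phi>' t (y - x) + \<psi>' t (y - x))) \<le> \<epsilon> * norm (y - x)"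
    proof eventually_elim
      case (elim y)
      show ?case
      proof
        fix t assume t: "t \<in> {0..T}"
        have "norm ((\<phi> y t - \<phi> x t - \<phi>' t (y - x)) + (\<psi> y t - \<psi> x t - \<psi>' t (y - x)))
            \<le> \<epsilon> / 2 * norm (y - x) + \<epsilon> / 2 * norm (y - x)"
          using elim t by (intro norm_triangle_mono) auto
        then show "norm (\<phi> y t + \<psi> y t - (\<phi> x t + \<psi> x t) - (\<phi>' t (y - x) + \<psi>' t (y - x)))
            \<le> \<epsilon> * norm (y - x)"
          by (simp add: algebra_simps)
      qed
    qed
  qed (use K M in \<open>auto intro!: linear_compose_add unif_deriv_linear[OF assms(1)]
      unif_deriv_linear[OF assms(2)] norm_triangle_mono simp: distrib_right\<close>)
qed

lemma unif_deriv_sum_list: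
  assumes "\<And>a. a \<in> set as \<Longrightarrow> unif_deriv d T (\<phi> a) (\<phi>' a) x"
  shows "unif_deriv d T (\<lambda>x t. \<Sum>a\<leftarrow>as. \<phi> a x t) (\<lambda>t h. \<Sum>a\<leftarrow>as. \<phi>' a t h) x"
  using assms by (induction as) (auto intro!: unif_deriv_zero unif_deriv_add)

lemma unif_deriv_sum:
  assumes "\<And>a. a \<in> A \<Longrightarrow> unif_deriv d T (\<phi> a) (\<phi>' a) x"
  shows "unif_deriv d T (\<lambda>x t. \<Sum>a\<in>A. \<phi> a x t) (\<lambda>t h. \<Sum>a\<in>A. \<phi>' a t h) x"
  using assms
  by (induction A rule: infinite_finite_induct) (auto intro!: unif_deriv_zero unif_deriv_add)

lemma unif_deriv_coord:
  assumes "unif_deriv d T \<phi> \<phi>' x"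
  shows "unif_deriv d T (\<lambda>x t. coord (\<phi> x t) b) (\<lambda>t h. coord (\<phi>' t h) b) x"
proof -
  obtain K where K: "\<And>t. t \<in> {0..T} \<Longrightarrow> norm (\<phi> x t) \<le> K"
    "\<And>t h. t \<in> {0..T} \<Longrightarrow> norm (\<phi>' t h) \<le> K * norm h"
    using unif_deriv_bound[OF assms] by metis
  show ?thesis
  proof (rule unif_derivI[where K = K and K' = K])
    fix t assume "t \<in> {0..T}"
    then show "linear (\<lambda>h. coord (\<phi>' t h) b)"
      using linear_compose[OF unif_deriv_linear[OF assms] bounded_linear.linear[OF bounded_linear_coord]]
      by (simp add: o_def)
  next
    fix \<epsilon> :: real assume "0 < \<epsilon>"
    from unif_deriv_eventually[OF assms this]
    show "\<forall>\<^sub>F y in at x within Rd d. \<forall>t\<in>{0..T}.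
      norm (coord (\<phi> y t) b - coord (\<phi> x t) b - coord (\<phi>' t (y - x)) b) \<le> \<epsilon> * norm (y - x)"
      by eventually_elim (auto simp flip: coord_simps intro: order.trans[OF abs_coord_le])
  qed (use K abs_coord_le order.trans in \<open>unfold real_norm_def, blast+\<close>)
qed

lemma unif_deriv_lipschitz:
  assumes "unif_deriv d T \<phi> \<phi>' x"
    and K: "\<forall>t\<in>{0..T}. \<forall>h. norm (\<phi>' t h) \<le> K * norm h"
  shows "\<forall>\<^sub>F y in at x within Rd d. \<forall>t\<in>{0..T}. norm (\<phi> y t - \<phi> x t) \<le> (K + 1) * norm (y - x)"
  using unif_deriv_eventually[OF assms(1) zero_less_one]
proof eventually_elim
  case (elim y)
  show ?case
  proof
    fix t assume t: "t \<in> {0..T}"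
    have "norm ((\<phi> y t - \<phi> x t - \<phi>' t (y - x)) + \<phi>' t (y - x)) \<le> 1 * norm (y - x) + K * norm (y - x)"
      using elim t K by (intro norm_triangle_mono) auto
    then show "norm (\<phi> y t - \<phi> x t) \<le> (K + 1) * norm (y - x)" by (simp add: algebra_simps)
  qed
qed

text \<open>The error consists of the expansion error of each factor times the other factor at
  \<open>x\<close>, and of the product of both increments, which is quadratic in
  \<open>norm (y - x)\<close> by \<open>unif_deriv_lipschitz\<close>.\<close>

lemma unif_deriv_scaleR:
  assumes "unif_deriv d T c c' x" "unif_deriv d T \<phi> \<phi>' x"
  shows "unif_deriv d T (\<lambda>x t. c x t *\<^sub>R \<phi> x t) (\<lambda>t h. c' t h *\<^sub>R \<phi> x t + c x t *\<^sub>R \<phi>' t h) x"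
proof -
  obtain M where M: "0 < M" "\<And>t. t \<in> {0..T} \<Longrightarrow> \<bar>c x t\<bar> \<le> M"
    "\<And>t h. t \<in> {0..T} \<Longrightarrow> norm (c' t h) \<le> M * norm h"
    using unif_deriv_bound[OF assms(1)] unfolding real_norm_def by metis
  obtain K where K: "0 < K" "\<And>t. t \<in> {0..T} \<Longrightarrow> norm (\<phi> x t) \<le> K"
    "\<And>t h. t \<in> {0..T} \<Longrightarrow> norm (\<phi>' t h) \<le> K * norm h"
    using unif_deriv_bound[OF assms(2)] by metis
  show ?thesis
  proof (rule unif_derivI[where K = "M * K" and K' = "M * K + M * K"])
    fix t assume t: "t \<in> {0..T}"
    show "linear (\<lambda>h. c' t h *\<^sub>R \<phi> x t + c x t *\<^sub>R \<phi>' t h)"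
      by (intro linearI) (simp_all add: unif_deriv_linear[OF assms(1) t] linear_add[of "c' t"]
          unif_deriv_linear[OF assms(2) t] linear_add[of "\<phi>' t"] linear_scale[of "c' t"]
          linear_scale[of "\<phi>' t"] algebra_simps)
    show "norm (c x t *\<^sub>R \<phi> x t) \<le> M * K"
      unfolding norm_scaleR using t M K by (intro mult_mono) auto
    fix h
    have "norm (c' t h *\<^sub>R \<phi> x t) \<le> (M * norm h) * K" "norm (c x t *\<^sub>R \<phi>' t h) \<le> M * (K * norm h)"
      unfolding norm_scaleR using t M K by (intro mult_mono; force)+
    then show "norm (c' t h *\<^sub>R \<phi> x t + c x t *\<^sub>R \<phi>' t h) \<le> (M * K + M * K) * norm h"
      by (intro order.trans[OF norm_triangle_ineq]) (simp add: algebra_simps)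
  next
    fix \<epsilon> :: real assume \<epsilon>: "0 < \<epsilon>"
    \<comment> \<open>Used as tolerance for both expansions and as radius for \<open>y\<close>; each
      of the three errors then costs at most a third of the allowance.\<close>
    define \<delta> where "\<delta> = \<epsilon> / (3 * ((M + 1) * (K + 1)))"
    have MK: "M \<le> (M + 1) * (K + 1)" "K \<le> (M + 1) * (K + 1)"
      using M(1) K(1) by (auto simp: algebra_simps)
    have MK0: "0 < (M + 1) * (K + 1)" using M(1) K(1) by simp
    have \<delta>: "0 < \<delta>" using \<epsilon> MK0 by (simp add: \<delta>_def)
    have \<delta>': "((M + 1) * (K + 1)) * \<delta> = \<epsilon> / 3"
    proof -
      have "p * (\<epsilon> / (3 * p)) = \<epsilon> / 3" if "0 < p" for p :: real
        using that by simp
      from this[OF MK0] show ?thesis unfolding \<delta>_def .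
    qed
    have \<delta>'': "M * \<delta> \<le> \<epsilon> / 3" "K * \<delta> \<le> \<epsilon> / 3"
      unfolding \<delta>'[symmetric] using MK \<delta> by (auto intro!: mult_right_mono)
    have "\<forall>t\<in>{0..T}. \<forall>h. norm (c' t h) \<le> M * norm h" "\<forall>t\<in>{0..T}. \<forall>h. norm (\<phi>' t h) \<le> K * norm h"
      using M(3) K(3) by blast+
    note lip = unif_deriv_lipschitz[OF assms(1) this(1)] unif_deriv_lipschitz[OF assms(2) this(2)]
    from unif_deriv_eventually[OF assms(1) \<delta>] unif_deriv_eventually[OF assms(2) \<delta>] lip
      eventually_norm_less[OF \<delta>, of x "Rd d"]
    show "\<forall>\<^sub>F y in at x within Rd d. \<forall>t\<in>{0..T}. norm (c y t *\<^sub>R \<phi> y t - c x t *\<^sub>R \<phi> x t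
        - (c' t (y - x) *\<^sub>R \<phi> x t + c x t *\<^sub>R \<phi>' t (y - x))) \<le> \<epsilon> * norm (y - x)"
    proof eventually_elim
      case (elim y)
      show ?case
      proof
        fix t assume t: "t \<in> {0..T}"
        let ?h = "y - x"
        have "norm ((c y t - c x t - c' t ?h) *\<^sub>R \<phi> x t) \<le> (\<delta> * norm ?h) * K"
          "norm (c x t *\<^sub>R (\<phi> y t - \<phi> x t - \<phi>' t ?h)) \<le> M * (\<delta> * norm ?h)"
          unfolding norm_scaleR using elim t M K \<delta> by (intro mult_mono; force)+
        moreover have "(\<delta> * norm ?h) * K \<le> \<epsilon> / 3 * norm ?h" "M * (\<delta> * norm ?h) \<le> \<epsilon> / 3 * norm ?h"
          using mult_right_mono[OF \<delta>''(1) norm_ge_zero[of ?h]]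
            mult_right_mono[OF \<delta>''(2) norm_ge_zero[of ?h]] by (simp_all add: algebra_simps)
        moreover have "norm ((c y t - c x t) *\<^sub>R (\<phi> y t - \<phi> x t)) \<le> \<epsilon> / 3 * norm ?h"
        proof -
          have "norm ((c y t - c x t) *\<^sub>R (\<phi> y t - \<phi> x t))
              \<le> ((M + 1) * norm ?h) * ((K + 1) * norm ?h)"
            unfolding norm_scaleR using elim t M(1) by (intro mult_mono) auto
          also have "\<dots> = ((M + 1) * (K + 1) * norm ?h) * norm ?h" by (simp add: algebra_simps)
          also have "\<dots> \<le> ((M + 1) * (K + 1) * \<delta>) * norm ?h"
            using elim MK0 by (intro mult_right_mono mult_left_mono) auto
          finally show ?thesis by (simp add: \<delta>')
        qed
        ultimately have "norm (((c y t - c x t - c' t ?h) *\<^sub>R \<phi> x t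
              + c x t *\<^sub>R (\<phi> y t - \<phi> x t - \<phi>' t ?h)) + (c y t - c x t) *\<^sub>R (\<phi> y t - \<phi> x t))
            \<le> (\<epsilon> / 3 * norm ?h + \<epsilon> / 3 * norm ?h) + \<epsilon> / 3 * norm ?h"
          by (intro norm_triangle_mono) auto
        then show "norm (c y t *\<^sub>R \<phi> y t - c x t *\<^sub>R \<phi> x t
            - (c' t ?h *\<^sub>R \<phi> x t + c x t *\<^sub>R \<phi>' t ?h)) \<le> \<epsilon> * norm ?h"
          by (simp add: algebra_simps)
      qed
    qed
  qed
qed

text \<open>Expanding \<open>W\<close> in the unit vectors turns the moving slot into a sum of
  scalar coordinates times values with a constant slot, so the product rule for
  \<open>scaleR\<close> applies.\<close>

lemma unif_deriv_slot:
  assumes x: "x \<in> Rd d"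
    and \<Phi>: "\<And>b. b < d \<Longrightarrow> unif_deriv d T (\<lambda>x t. \<Phi> x t (unit_rseq b)) (\<lambda>t h. \<Phi>' t h (unit_rseq b)) x"
    and W: "unif_deriv d T W W' x" "\<And>y t. y \<in> Rd d \<Longrightarrow> t \<in> {0..T} \<Longrightarrow> W y t \<in> Rd d"
      "\<And>t h. t \<in> {0..T} \<Longrightarrow> W' t h \<in> Rd d"
    and lin: "\<And>y t. y \<in> Rd d \<Longrightarrow> t \<in> {0..T} \<Longrightarrow> linear (\<lambda>w. \<Phi> y t (proj d w))"
      "\<And>t h. t \<in> {0..T} \<Longrightarrow> linear (\<lambda>w. \<Phi>' t h (proj d w))"
  shows "unif_deriv d T (\<lambda>x t. \<Phi> x t (W x t)) (\<lambda>t h. \<Phi>' t h (W x t) + \<Phi> x t (W' t h)) x"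
proof (rule unif_deriv_cong)
  show "unif_deriv d T (\<lambda>x t. \<Sum>b<d. coord (W x t) b *\<^sub>R \<Phi> x t (unit_rseq b))
    (\<lambda>t h. \<Sum>b<d. coord (W' t h) b *\<^sub>R \<Phi> x t (unit_rseq b)
      + coord (W x t) b *\<^sub>R \<Phi>' t h (unit_rseq b)) x"
    by (intro unif_deriv_sum unif_deriv_scaleR unif_deriv_coord W(1) \<Phi>) auto
  show "\<Phi> y t (W y t) = (\<Sum>b<d. coord (W y t) b *\<^sub>R \<Phi> y t (unit_rseq b))"
    if "y \<in> Rd d" "t \<in> {0..T}" for y t
    using that by (intro linear_proj_expand lin W)
  show "\<Phi>' t h (W x t) + \<Phi> x t (W' t h) = (\<Sum>b<d. coord (W' t h) b *\<^sub>R \<Phi> x t (unit_rseq b)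
      + coord (W x t) b *\<^sub>R \<Phi>' t h (unit_rseq b))" if t: "t \<in> {0..T}" for t h
    by (simp add: sum.distrib linear_proj_expand[OF lin(1)[OF x t] W(3)[OF t]]
      linear_proj_expand[OF lin(2)[OF t] W(2)[OF x t]])
qed (rule x)

text \<open>The trajectory \<open>u x\<close> over \<open>{0..T}\<close> is compact, so
  \<open>g\<close> has an expansion along it with one radius for all times, and \<open>g'\<close> is
  bounded there.\<close>

lemma unif_deriv_compose:
  assumes u: "unif_deriv d T u u' x" "continuous_on {0..T} (u x)" and x: "x \<in> Rd d"
    and uR: "\<And>y t. y \<in> Rd d \<Longrightarrow> t \<in> {0..T} \<Longrightarrow> u y t \<in> Rd d"
      "\<And>t h. t \<in> {0..T} \<Longrightarrow> u' t h \<in> Rd d"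
    and g: "\<And>y. y \<in> Rd d \<Longrightarrow> (g has_derivative (\<lambda>h. g' y (proj d h))) (at y within Rd d)"
    and cont: "\<And>v. v \<in> Rd d \<Longrightarrow> continuous_on (Rd d) (\<lambda>y. g' y v)"
  shows "unif_deriv d T (\<lambda>x t. g (u x t)) (\<lambda>t h. g' (u x t) (u' t h)) x"
proof -
  have lin: "linear (\<lambda>h. g' y (proj d h))" if "y \<in> Rd d" for y
    using g[OF that] by (auto dest: has_derivative_bounded_linear bounded_linear.linear)
  have gcont: "continuous_on (Rd d) g"
    using g by (intro has_derivative_continuous_on)
  have comp: "compact (u x ` {0..T})"
    by (intro compact_continuous_image u) simp
  have sub: "u x ` {0..T} \<subseteq> Rd d" using uR x by auto
  have "\<exists>B. \<forall>t\<in>{0..T}. norm (\<gamma> (u x t)) \<le> B"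
    if "continuous_on (Rd d) \<gamma>" for \<gamma> :: "rseq \<Rightarrow> 'a"
    using compact_imp_bounded[OF compact_continuous_image[OF continuous_on_subset[OF that sub] comp]]
    unfolding bounded_iff by auto
  note bdd = this
  obtain G where G: "\<And>t. t \<in> {0..T} \<Longrightarrow> norm (g (u x t)) \<le> G"
    using bdd[OF gcont] by blast
  have "\<exists>B. \<forall>t\<in>{0..T}. norm (g' (u x t) (unit_rseq b)) \<le> B" if "b < d" for b
    using that by (intro bdd cont) auto
  then obtain B where B: "\<And>b t. b < d \<Longrightarrow> t \<in> {0..T} \<Longrightarrow> norm (g' (u x t) (unit_rseq b)) \<le> B b"
    by metis
  \<comment> \<open>Bounds the operator norm of \<open>g'\<close> along the trajectory through its
    values on the unit vectors.\<close>
  define M where "M = (\<Sum>b<d. max 0 (B b))"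
  have M: "norm (g' (u x t) w) \<le> M * norm w" if "t \<in> {0..T}" "w \<in> Rd d" for t w
  proof -
    have "norm (g' (u x t) w) = norm (\<Sum>b<d. coord w b *\<^sub>R g' (u x t) (unit_rseq b))"
      using linear_proj_expand[OF lin[OF uR(1)[OF x that(1)]] that(2)] by simp
    also have "\<dots> \<le> (\<Sum>b<d. norm w * max 0 (B b))"
      unfolding norm_scaleR using B that
      by (intro sum_norm_le) (auto intro!: mult_mono abs_coord_le simp: le_max_iff_disj)
    finally show ?thesis by (simp add: M_def sum_distrib_left mult.commute)
  qed
  have M0: "0 \<le> M" by (simp add: M_def sum_nonneg)
  obtain K where K: "0 < K" "\<And>t h. t \<in> {0..T} \<Longrightarrow> norm (u' t h) \<le> K * norm h"
    using unif_deriv_bound[OF u(1)] by metis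
  show ?thesis
  proof (rule unif_derivI[where K = G and K' = "M * K"])
    fix t assume t: "t \<in> {0..T}"
    show "linear (\<lambda>h. g' (u x t) (u' t h))"
      using linear_compose[OF unif_deriv_linear[OF u(1) t] lin[OF uR(1)[OF x t]]] uR(2)[OF t]
      by (simp add: o_def)
    fix h
    show "norm (g' (u x t) (u' t h)) \<le> (M * K) * norm h"
      using order.trans[OF M[OF t uR(2)[OF t]] mult_left_mono[OF K(2)[OF t, of h] M0]]
      by (simp add: mult.assoc)
  next
    fix \<epsilon> :: real assume \<epsilon>: "0 < \<epsilon>"
    \<comment> \<open>\<open>\<epsilon>1\<close> pays for expanding \<open>g\<close>, where the
      increment of \<open>u\<close> costs a factor \<open>K + 1\<close>; \<open>\<epsilon>2\<close>
      pays for replacing that increment by \<open>u'\<close>, at a factor \<open>M\<close>.\<close>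
    define \<epsilon>1 where "\<epsilon>1 = \<epsilon> / (2 * (K + 1))"
    define \<epsilon>2 where "\<epsilon>2 = \<epsilon> / (2 * (M + 1))"
    have \<epsilon>12: "0 < \<epsilon>1" "0 < \<epsilon>2" "\<epsilon>1 * (K + 1) = \<epsilon> / 2" "M * \<epsilon>2 \<le> \<epsilon> / 2"
      using \<epsilon> K(1) M0 by (auto simp: \<epsilon>1_def \<epsilon>2_def field_simps)
    obtain \<delta> where \<delta>: "0 < \<delta>" "\<And>p q. p \<in> u x ` {0..T} \<Longrightarrow> q \<in> Rd d \<Longrightarrow> norm (q - p) < \<delta> \<Longrightarrow>
        norm (g q - g p - g' p (q - p)) \<le> \<epsilon>1 * norm (q - p)"
      using uniformly_differentiable_on_compact[OF comp sub g cont \<epsilon>12(1)] by metis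
    have "0 < \<delta> / (K + 1)" using \<delta>(1) K(1) by simp
    note small = eventually_norm_less[OF this, of x "Rd d"]
    have "\<forall>t\<in>{0..T}. \<forall>h. norm (u' t h) \<le> K * norm h" using K(2) by blast
    from unif_deriv_eventually[OF u(1) \<epsilon>12(2)] unif_deriv_lipschitz[OF u(1) this] small
      eventually_within_mem[of "Rd d" x]
    show "\<forall>\<^sub>F y in at x within Rd d. \<forall>t\<in>{0..T}. norm (g (u y t) - g (u x t)
        - g' (u x t) (u' t (y - x))) \<le> \<epsilon> * norm (y - x)"
    proof eventually_elim
      case (elim y)
      show ?case
      proof
        fix t assume t: "t \<in> {0..T}"
        let ?h = "y - x" and ?k = "u y t - u x t"
        have R: "u y t \<in> Rd d" "u x t \<in> Rd d" "u' t ?h \<in> Rd d" using uR x elim t by auto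
        have k: "norm ?k \<le> (K + 1) * norm ?h" using elim t by auto
        also have "\<dots> < \<delta>" using elim K(1) by (simp add: pos_less_divide_eq mult.commute)
        finally have "norm (g (u y t) - g (u x t) - g' (u x t) ?k) \<le> \<epsilon>1 * norm ?k"
          using \<delta>(2) R t by auto
        also have "\<dots> \<le> \<epsilon>1 * ((K + 1) * norm ?h)"
          using k \<epsilon>12(1) by (intro mult_left_mono) auto
        also have "\<dots> = \<epsilon> / 2 * norm ?h" by (simp only: mult.assoc[symmetric] \<epsilon>12(3))
        finally have 1: "norm (g (u y t) - g (u x t) - g' (u x t) ?k) \<le> \<epsilon> / 2 * norm ?h" .
        have "norm (g' (u x t) (?k - u' t ?h)) \<le> M * (\<epsilon>2 * norm ?h)"
          using elim t R by (intro order.trans[OF M] mult_left_mono M0) auto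
        also have "\<dots> \<le> \<epsilon> / 2 * norm ?h"
          using mult_right_mono[OF \<epsilon>12(4) norm_ge_zero[of ?h]] by (simp add: mult.assoc)
        finally have 2: "norm (g' (u x t) (?k - u' t ?h)) \<le> \<epsilon> / 2 * norm ?h" .
        have "g' (u x t) (?k - u' t ?h) = g' (u x t) ?k - g' (u x t) (u' t ?h)"
          using linear_diff[OF lin[OF R(2)], of ?k "u' t ?h"] R by simp
        then have "norm (g (u y t) - g (u x t) - g' (u x t) (u' t ?h))
            = norm ((g (u y t) - g (u x t) - g' (u x t) ?k) + g' (u x t) (?k - u' t ?h))"
          by simp
        also have "\<dots> \<le> \<epsilon> / 2 * norm ?h + \<epsilon> / 2 * norm ?h"
          by (intro norm_triangle_mono 1 2)
        finally show "norm (g (u y t) - g (u x t) - g' (u x t) (u' t ?h)) \<le> \<epsilon> * norm ?h" by simp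
      qed
    qed
  qed (rule G)
qed

text \<open>A candidate \<open>z\<close> for the derivative of the family \<open>\<phi>\<close> of solutions is confirmed by Gronwall's
  inequality for the linearisation error. The hypothesis \<open>err\<close> tolerates a multiple of that error,
  so that nothing has to be known about the dependence of \<open>\<phi>\<close> on its parameter.\<close>

lemma unif_deriv_ode:
  fixes \<phi> :: "rseq \<Rightarrow> real \<Rightarrow> 'a::real_inner"
  assumes L: "0 < L" and x: "x \<in> Rd d"
    and \<phi>: "\<And>y t. y \<in> Rd d \<Longrightarrow> t \<in> {0..T} \<Longrightarrow> (\<phi> y has_vector_derivative g y t) (at t within {0..T})"
    and z: "\<And>b t. b < d \<Longrightarrow> t \<in> {0..T} \<Longrightarrow> (z b has_vector_derivative \<gamma> b t) (at t within {0..T})"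
    and init: "\<And>y. y \<in> Rd d \<Longrightarrow> \<phi> y 0 - \<phi> x 0 = (\<Sum>b<d. coord (y - x) b *\<^sub>R z b 0)"
    and err: "\<And>\<epsilon>. 0 < \<epsilon> \<Longrightarrow> \<forall>\<^sub>F y in at x within Rd d. \<forall>t\<in>{0..T}.
      norm (g y t - g x t - (\<Sum>b<d. coord (y - x) b *\<^sub>R \<gamma> b t))
        \<le> L * norm (\<phi> y t - \<phi> x t - (\<Sum>b<d. coord (y - x) b *\<^sub>R z b t)) + \<epsilon> * norm (y - x)"
  shows "unif_deriv d T \<phi> (\<lambda>t h. \<Sum>b<d. coord h b *\<^sub>R z b t) x"
proof -
  have bdd: "\<exists>B. \<forall>t\<in>{0..T}. norm (w t) \<le> B"
    if "\<And>t. t \<in> {0..T} \<Longrightarrow> (w has_vector_derivative w' t) (at t within {0..T})" for w w' :: "real \<Rightarrow> 'a"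
    using compact_imp_bounded[OF compact_continuous_image[OF continuous_on_vector_derivative[OF that]]]
    unfolding bounded_iff by auto
  obtain K where K: "\<And>t. t \<in> {0..T} \<Longrightarrow> norm (\<phi> x t) \<le> K"
    using bdd[OF \<phi>[OF x]] by blast
  have "\<exists>B. \<forall>t\<in>{0..T}. norm (z b t) \<le> B" if "b < d" for b
    using bdd[OF z[OF that]] by auto
  then obtain B where B: "\<And>b t. b < d \<Longrightarrow> t \<in> {0..T} \<Longrightarrow> norm (z b t) \<le> B b" by metis
  show ?thesis
  proof (rule unif_derivI[where K = K and K' = "\<Sum>b<d. max 0 (B b)"])
    fix t assume t: "t \<in> {0..T}"
    show "linear (\<lambda>h. \<Sum>b<d. coord h b *\<^sub>R z b t)"
      by (intro linearI) (simp_all add: scaleR_left_distrib sum.distrib scaleR_sum_right)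
    fix h
    have "norm (\<Sum>b<d. coord h b *\<^sub>R z b t) \<le> (\<Sum>b<d. norm h * max 0 (B b))"
      unfolding norm_scaleR using B t
      by (intro sum_norm_le) (auto intro!: mult_mono abs_coord_le simp: le_max_iff_disj)
    then show "norm (\<Sum>b<d. coord h b *\<^sub>R z b t) \<le> (\<Sum>b<d. max 0 (B b)) * norm h"
      by (simp add: sum_distrib_left mult.commute)
  next
    fix \<epsilon> :: real assume \<epsilon>: "0 < \<epsilon>"
    \<comment> \<open>Cancels the Gronwall factor \<open>exp (L * T) / L\<close>; the error itself
      starts at 0 by \<open>init\<close>.\<close>
    define \<epsilon>' where "\<epsilon>' = \<epsilon> * L / exp (L * T)"
    have \<epsilon>': "0 < \<epsilon>'" using \<epsilon> L by (simp add: \<epsilon>'_def)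
    show "\<forall>\<^sub>F y in at x within Rd d. \<forall>t\<in>{0..T}.
      norm (\<phi> y t - \<phi> x t - (\<Sum>b<d. coord (y - x) b *\<^sub>R z b t)) \<le> \<epsilon> * norm (y - x)"
      using err[OF \<epsilon>'] eventually_within_mem[of "Rd d" x]
    proof eventually_elim
      case (elim y)
      let ?e = "\<lambda>t. \<phi> y t - \<phi> x t - (\<Sum>b<d. coord (y - x) b *\<^sub>R z b t)"
      show ?case
      proof
        fix t assume t: "t \<in> {0..T}"
        have "norm (?e t) \<le> norm (?e 0) * exp (L * t) + (\<epsilon>' * norm (y - x)) / L * (exp (L * t) - 1)"
        proof (rule gronwall[where T = T and e = ?e and
              e' = "\<lambda>s. g y s - g x s - (\<Sum>b<d. coord (y - x) b *\<^sub>R \<gamma> b s)"])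
          fix s assume s: "s \<in> {0..T}"
          show "(?e has_vector_derivative g y s - g x s - (\<Sum>b<d. coord (y - x) b *\<^sub>R \<gamma> b s)) (at s within {0..T})"
            by (intro has_vector_derivative_diff has_vector_derivative_sum \<phi> x elim(2) s z
              bounded_linear.has_vector_derivative[OF bounded_linear_scaleR_right]) simp
          show "norm (g y s - g x s - (\<Sum>b<d. coord (y - x) b *\<^sub>R \<gamma> b s)) \<le> L * norm (?e s) + \<epsilon>' * norm (y - x)"
            using elim s by auto
        qed (use \<epsilon>' L t in auto)
        also have "\<dots> = (\<epsilon>' * norm (y - x)) / L * (exp (L * t) - 1)"
          using init[OF elim(2)] by simp
        also have "\<dots> \<le> (\<epsilon>' * norm (y - x)) / L * exp (L * T)"
        proof (rule mult_left_mono)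
          have "exp (L * t) \<le> exp (L * T)" using t L by simp
          then show "exp (L * t) - 1 \<le> exp (L * T)" by linarith
        qed (use L \<epsilon>' in simp)
        also have "\<dots> = \<epsilon> * norm (y - x)"
          using L by (simp add: \<epsilon>'_def)
        finally show "norm (?e t) \<le> \<epsilon> * norm (y - x)" .
      qed
    qed
  qed (rule K)
qed

subsection \<open>The higher variational equations\<close>

declare nth_deriv.simps(2) [simp del]

definition expand :: "'a \<Rightarrow> 'a list list \<Rightarrow> 'a list list list"
  where "expand v T = ([v] # T) # map (\<lambda>i. T[i := v # T ! i]) [0..<length T]"

text \<open>By the chain rule, the \<open>k\<close>-th derivative of \<open>f \<circ> u\<close> in the directions \<open>vs\<close> is a sum of terms
  that apply a derivative of \<open>f\<close> of order \<open>m\<close> to derivatives of \<open>u\<close> in the directions of \<open>m\<close> sublists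
  (blocks) of \<open>vs\<close>. Such a term is encoded by its list of blocks, and \<open>expand v\<close> lists the terms
  arising from one term by differentiating in direction \<open>v\<close>. In \<open>lower vs\<close> the term \<open>[vs]\<close>, the
  only one containing the \<open>k\<close>-th derivative of \<open>u\<close>, is left out.\<close>

fun lower :: "'a list \<Rightarrow> 'a list list list" where
  "lower (v # w # vs) = [[v], w # vs] # concat (map (expand v) (lower (w # vs)))"
| "lower _ = []"

lemma expand_blocks:
  assumes "T' \<in> set (expand v T)"
  shows "length T' \<le> Suc (length T)" "T \<noteq> [] \<Longrightarrow> T' \<noteq> []"
    "B \<in> set T' \<Longrightarrow> B = [v] \<or> B \<in> set T \<or> (\<exists>B'\<in>set T. B = v # B')"
proof -
  consider "T' = [v] # T" | i where "i < length T" "T' = T[i := v # T ! i]"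
    using assms by (auto simp: expand_def)
  then show "length T' \<le> Suc (length T)" "T \<noteq> [] \<Longrightarrow> T' \<noteq> []"
    "B \<in> set T' \<Longrightarrow> B = [v] \<or> B \<in> set T \<or> (\<exists>B'\<in>set T. B = v # B')"
    using set_update_subset_insert[of T _ "v # T ! _"] by (cases; force)+
qed

text \<open>Makes the induction on the order work: blocks are shorter than \<open>vs\<close>, so
  only lower derivatives of the flow occur, and the number of blocks, which is the order of the
  derivative of \<open>f\<close>, does not exceed the order under consideration.\<close>

lemma lower_blocks:
  "T \<in> set (lower vs) \<Longrightarrow> length T \<le> length vs \<and> T \<noteq> [] \<and>
    (\<forall>B\<in>set T. B \<noteq> [] \<and> length B < length vs \<and> set B \<subseteq> set vs)"
proof (induction vs arbitrary: T rule: lower.induct)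
  case (1 v w vs)
  show ?case
  proof (cases "T = [[v], w # vs]")
    case False
    then obtain T0 where T0: "T0 \<in> set (lower (w # vs))" "T \<in> set (expand v T0)"
      using 1(2) by auto
    note IH = 1(1)[OF T0(1)]
    have "B \<noteq> [] \<and> length B < length (v # w # vs) \<and> set B \<subseteq> set (v # w # vs)" if "B \<in> set T" for B
      using expand_blocks(3)[OF T0(2) that] IH by fastforce
    then show ?thesis using expand_blocks(1,2)[OF T0(2)] IH by force
  qed auto
qed auto

text \<open>A term with at most m blocks produces at most m + 1 terms, and one further term is
  added, so the step rests on 1 + (m! - 1)(m + 1) < (m + 1)!. The exact number is a Bell number
  minus 1.\<close>

lemma length_lower: "vs \<noteq> [] \<Longrightarrow> length (lower vs) < fact (length vs)"
proof (induction vs rule: lower.induct)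
  case (1 v w vs)
  let ?m = "length (w # vs)"
  have "length (lower (v # w # vs)) = Suc (\<Sum>T\<leftarrow>lower (w # vs). length (expand v T))"
    by (simp add: length_concat o_def)
  also have "(\<Sum>T\<leftarrow>lower (w # vs). length (expand v T)) \<le> (\<Sum>T\<leftarrow>lower (w # vs). Suc ?m)"
    using lower_blocks[of _ "w # vs"] by (intro sum_list_mono) (auto simp: expand_def)
  also have "\<dots> = length (lower (w # vs)) * Suc ?m" by (simp add: sum_list_triv)
  also have "\<dots> \<le> (fact ?m - 1) * Suc ?m"
    using 1 by (intro mult_right_mono) auto
  finally have "length (lower (v # w # vs)) \<le> Suc ((fact ?m - 1) * Suc ?m)" by simp
  also have "\<dots> < fact (Suc ?m)"
  proof -
    obtain k where "fact ?m = Suc k" using fact_ge_1[of ?m, where 'a = nat] by (metis Suc_le_D One_nat_def)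
    then show ?thesis unfolding fact_Suc by simp
  qed
  finally show ?case by simp
qed auto

lemma continuous_on_sum_list:
  fixes \<phi> :: "'b \<Rightarrow> 'c::topological_space \<Rightarrow> 'a::real_normed_vector"
  shows "(\<And>a. a \<in> set as \<Longrightarrow> continuous_on S (\<phi> a)) \<Longrightarrow> continuous_on S (\<lambda>t. \<Sum>a\<leftarrow>as. \<phi> a t)"
  by (induction as) (auto intro!: continuous_intros)

text \<open>\<open>T\<close> stands for the bound on the time step. The order \<open>n\<close> will
  be the \<open>k\<close> of the theorem rather than \<open>\<beta>\<close>, so that only
  \<open>L 1\<close> to \<open>L k\<close> can enter. \<open>f_bound\<close> covers arbitrary
  directions because the vectors inserted into the derivatives of \<open>f\<close> are derivatives
  of the flow, not unit vectors.\<close>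

locale smooth_field =
  fixes d n :: nat and f :: "rseq \<Rightarrow> rseq" and L :: "nat \<Rightarrow> real" and T :: real
  assumes f_Rd: "f \<in> Rd d \<rightarrow> Rd d"
    and f_C: "n_times_continuously_differentiable d n f"
    and n_pos: "0 < n" and L1_pos: "0 < L 1" and T_pos: "0 < T"
    and f_bound: "\<And>x vs. x \<in> Rd d \<Longrightarrow> vs \<noteq> [] \<Longrightarrow> length vs \<le> n \<Longrightarrow> set vs \<subseteq> Rd d \<Longrightarrow>
      norm (nth_deriv d f x vs) \<le> L (length vs) * prod_list (map norm vs)"
begin

lemmas f_D = n_times_continuously_differentiable_imp_differentiable[OF f_C]

lemma Df_linear: "x \<in> Rd d \<Longrightarrow> linear (\<lambda>w. nth_deriv d f x [proj d w])"
  using nth_deriv_linear[OF f_D, of "[]" "[]"] n_pos by simp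

lemma Df_diff:
  "x \<in> Rd d \<Longrightarrow> v \<in> Rd d \<Longrightarrow> w \<in> Rd d \<Longrightarrow>
    nth_deriv d f x [v - w] = nth_deriv d f x [v] - nth_deriv d f x [w]"
  using linear_diff[OF Df_linear, of x v w] by simp

lemma Df_bound: "x \<in> Rd d \<Longrightarrow> w \<in> Rd d \<Longrightarrow> norm (nth_deriv d f x [w]) \<le> L 1 * norm w"
  using f_bound[of x "[w]"] n_pos by simp

lemma f_lipschitz:
  assumes "x \<in> Rd d" "y \<in> Rd d"
  shows "norm (f x - f y) \<le> L 1 * norm (x - y)"
proof (rule differentiable_bound[OF convex_Rd])
  fix z assume z: "z \<in> Rd d"
  show "(f has_derivative (\<lambda>h. nth_deriv d f z [proj d h])) (at z within Rd d)"
    using nth_deriv_has_derivative[OF f_D, of "[]" z] n_pos z by simp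
  show "onorm (\<lambda>h. nth_deriv d f z [proj d h]) \<le> L 1"
  proof (rule onorm_bound)
    fix h
    show "norm (nth_deriv d f z [proj d h]) \<le> L 1 * norm h"
      using order.trans[OF Df_bound[OF z, of "proj d h"] mult_left_mono[OF norm_proj_le, of "L 1" d h]]
        L1_pos by simp
  qed (use L1_pos in simp)
qed (use assms in auto)

text \<open>The sign \<open>\<sigma> = -1\<close> covers time-reversed solutions: uniqueness is
  required at negative times as well.\<close>

lemma solutions_lipschitz:
  assumes \<sigma>: "\<bar>\<sigma>\<bar> = 1" and t: "0 \<le> t"
    and u: "\<And>s. u s \<in> Rd d" "\<And>s. (u has_vector_derivative \<sigma> *\<^sub>R f (u s)) (at s)"
    and w: "\<And>s. w s \<in> Rd d" "\<And>s. (w has_vector_derivative \<sigma> *\<^sub>R f (w s)) (at s)"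
  shows "norm (u t - w t) \<le> norm (u 0 - w 0) * exp (L 1 * t)"
proof -
  have "norm (u t - w t) \<le> norm (u 0 - w 0) * exp (L 1 * t) + 0 / L 1 * (exp (L 1 * t) - 1)"
  proof (rule gronwall[where e = "\<lambda>t. u t - w t" and T = t and e' = "\<lambda>s. \<sigma> *\<^sub>R f (u s) - \<sigma> *\<^sub>R f (w s)"])
    fix s
    show "((\<lambda>t. u t - w t) has_vector_derivative \<sigma> *\<^sub>R f (u s) - \<sigma> *\<^sub>R f (w s)) (at s within {0..t})"
      by (intro has_vector_derivative_diff has_vector_derivative_at_within[OF u(2)]
          has_vector_derivative_at_within[OF w(2)])
    show "norm (\<sigma> *\<^sub>R f (u s) - \<sigma> *\<^sub>R f (w s)) \<le> L 1 * norm (u s - w s) + 0"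
      using f_lipschitz[OF u(1) w(1)] \<sigma> by (simp add: scaleR_diff_right[symmetric])
  qed (use L1_pos t in auto)
  then show ?thesis by simp
qed

lemma flow_solution:
  assumes "x \<in> Rd d"
  shows "is_solution d f x (flow d f x)"
proof -
  have "\<exists>u. u 0 = x \<and> (\<forall>t. u t \<in> Rd d \<and> (u has_vector_derivative f (u t)) (at t))"
  proof (rule lipschitz_ode_exists[OF assms L1_pos])
    fix u :: "real \<Rightarrow> rseq" assume "continuous_on UNIV u" "\<And>t. u t \<in> Rd d"
    then show "continuous_on UNIV (\<lambda>t. f (u t))"
      using nth_deriv_continuous_on[OF f_C, of "[]"] by (auto intro!: continuous_on_compose2[of "Rd d" f])
  qed (use f_Rd f_lipschitz in auto)
  then obtain u where u: "is_solution d f x u"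
    by (auto simp: is_solution_def)
  moreover have "w = u" if w: "is_solution d f x w" for w
  proof
    fix t
    have w0: "w 0 = x" "u 0 = x" and R: "\<And>s. w s \<in> Rd d" "\<And>s. u s \<in> Rd d"
      and der: "\<And>s. (w has_vector_derivative f (w s)) (at s)" "\<And>s. (u has_vector_derivative f (u s)) (at s)"
      using u w by (auto simp: is_solution_def)
    show "w t = u t"
    proof (cases "0 \<le> t")
      case True
      then show ?thesis
        using solutions_lipschitz[of 1 t w u] R der w0 by simp
    next
      case False
      then show ?thesis
        using solutions_lipschitz[of "-1" "- t" "\<lambda>s. w (- s)" "\<lambda>s. u (- s)"] R w0
          vector_derivative_reflect[OF der(1)] vector_derivative_reflect[OF der(2)] by simp
    qed
  qed
  ultimately show ?thesis unfolding flow_def by (rule theI)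
qed

lemma flow_Rd: "x \<in> Rd d \<Longrightarrow> flow d f x t \<in> Rd d"
  and flow_0: "x \<in> Rd d \<Longrightarrow> flow d f x 0 = x"
  and flow_derivative: "x \<in> Rd d \<Longrightarrow> (flow d f x has_vector_derivative f (flow d f x t)) (at t)"
  using flow_solution by (auto simp: is_solution_def)

section \<open>Iterated derivatives of the flow and the equations expected of them\<close>

definition flow_deriv :: "rseq list \<Rightarrow> rseq \<Rightarrow> real \<Rightarrow> rseq"
  where "flow_deriv vs x t = nth_deriv d (\<lambda>y. flow d f y t) x vs"

definition term_value :: "rseq list list \<Rightarrow> rseq \<Rightarrow> real \<Rightarrow> rseq"
  where "term_value S x t = nth_deriv d f (flow d f x t) (map (\<lambda>B. flow_deriv B x t) S)"

definition remainder :: "rseq list \<Rightarrow> rseq \<Rightarrow> real \<Rightarrow> rseq"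
  where "remainder vs x t = (\<Sum>S\<leftarrow>lower vs. term_value S x t)"

text \<open>The empty list gives the equation of the flow itself, so that one induction step serves
  all orders.\<close>

definition variational_rhs :: "rseq list \<Rightarrow> rseq \<Rightarrow> real \<Rightarrow> rseq"
  where "variational_rhs vs x t = (if vs = [] then f (flow d f x t)
    else nth_deriv d f (flow d f x t) [flow_deriv vs x t] + remainder vs x t)"

text \<open>The iterated derivative of the identity. It is both the value of
  \<open>flow_deriv\<close> at time 0 and the difference between the derivatives of the flow and of
  the increment.\<close>

definition initial :: "rseq list \<Rightarrow> rseq \<Rightarrow> rseq"
  where "initial vs x = (if vs = [] then x else if length vs = 1 then hd vs else 0)"

definition solves :: "rseq list \<Rightarrow> rseq \<Rightarrow> bool"
  where "solves vs x \<longleftrightarrow> flow_deriv vs x 0 = initial vs x \<and> (\<forall>t\<in>{0..T}. flow_deriv vs x t \<in> Rd d \<and>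
    (flow_deriv vs x has_vector_derivative variational_rhs vs x t) (at t within {0..T}))"

text \<open>The induction hypothesis. Differentiability stops one order earlier because
  differentiating a derivative of order \<open>m\<close> leads to order
  \<open>m + 1\<close>.\<close>

definition regular :: "nat \<Rightarrow> bool"
  where "regular m \<longleftrightarrow> (\<forall>vs x. set vs \<subseteq> Rd d \<longrightarrow> x \<in> Rd d \<longrightarrow>
    (length vs \<le> m \<longrightarrow> solves vs x) \<and>
    (length vs < m \<longrightarrow> unif_deriv d T (flow_deriv vs) (\<lambda>t h. flow_deriv (proj d h # vs) x t) x))"

lemma flow_deriv_Nil [simp]: "flow_deriv [] = flow d f"
  by (simp add: flow_deriv_def fun_eq_iff)

lemma flow_deriv_Cons:
  "flow_deriv (v # vs) x t = frechet_derivative (\<lambda>y. flow_deriv vs y t) (at x within Rd d) v"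
  by (simp add: flow_deriv_def nth_deriv.simps(2))

lemma regularD:
  assumes "regular m" "set vs \<subseteq> Rd d" "x \<in> Rd d"
  shows "length vs \<le> m \<Longrightarrow> flow_deriv vs x 0 = initial vs x"
    "length vs \<le> m \<Longrightarrow> t \<in> {0..T} \<Longrightarrow> flow_deriv vs x t \<in> Rd d"
    "length vs \<le> m \<Longrightarrow> t \<in> {0..T} \<Longrightarrow>
      (flow_deriv vs x has_vector_derivative variational_rhs vs x t) (at t within {0..T})"
    "length vs < m \<Longrightarrow> unif_deriv d T (flow_deriv vs) (\<lambda>t h. flow_deriv (proj d h # vs) x t) x"
  using assms by (auto simp: regular_def solves_def)

lemma regular_continuous:
  assumes "regular m" "set vs \<subseteq> Rd d" "x \<in> Rd d" "length vs \<le> m"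
  shows "continuous_on {0..T} (flow_deriv vs x)"
  by (rule continuous_on_vector_derivative[OF regularD(3)[OF assms]])

lemma regular_0: "regular 0"
  using flow_0 flow_Rd has_vector_derivative_at_within[OF flow_derivative]
  by (auto simp: regular_def solves_def initial_def variational_rhs_def)

text \<open>The first summand comes from moving the base point, each of the others from moving one
  block; this is the pattern of \<open>expand\<close>. The induction takes blocks off
  \<open>S\<close> and replaces them by unit vectors collected in \<open>cs\<close>.\<close>

lemma unif_deriv_nth_deriv:
  assumes reg: "regular m" "0 < m" and x: "x \<in> Rd d"
    and "length cs + length S < n" "set cs \<subseteq> Rd d" "\<And>B. B \<in> set S \<Longrightarrow> set B \<subseteq> Rd d \<and> length B < m"
  shows "unif_deriv d T
    (\<lambda>x t. nth_deriv d f (flow d f x t) (cs @ map (\<lambda>B. flow_deriv B x t) S))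
    (\<lambda>t h. nth_deriv d f (flow d f x t) (flow_deriv [proj d h] x t # cs @ map (\<lambda>B. flow_deriv B x t) S)
      + (\<Sum>i<length S. nth_deriv d f (flow d f x t)
          (cs @ map (\<lambda>B. flow_deriv B x t) (S[i := proj d h # S ! i])))) x"
  using assms(4-)
proof (induction S arbitrary: cs)
  case Nil
  have "unif_deriv d T (\<lambda>x t. nth_deriv d f (flow_deriv [] x t) cs)
      (\<lambda>t h. nth_deriv d f (flow_deriv [] x t) (flow_deriv [proj d h] x t # cs)) x"
    using Nil regularD(4)[OF reg(1), of "[]" x] regularD(2)[OF reg(1), of "[proj d _]" x] x reg(2)
    by (intro unif_deriv_compose[where g' = "\<lambda>y h. nth_deriv d f y (h # cs)"]
        nth_deriv_has_derivative[OF f_D] nth_deriv_continuous_on[OF f_C] regular_continuous[OF reg(1)])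
      (simp_all add: flow_Rd)
  then show ?case by simp
next
  case (Cons B S)
  define \<Phi> where "\<Phi> y t w = nth_deriv d f (flow d f y t) (cs @ w # map (\<lambda>B. flow_deriv B y t) S)" for y t w
  define \<Phi>' where "\<Phi>' t h w = nth_deriv d f (flow d f x t)
      (flow_deriv [proj d h] x t # (cs @ [w]) @ map (\<lambda>B. flow_deriv B x t) S)
    + (\<Sum>i<length S. nth_deriv d f (flow d f x t)
        ((cs @ [w]) @ map (\<lambda>B. flow_deriv B x t) (S[i := proj d h # S ! i])))" for t h w
  have B: "set B \<subseteq> Rd d" "length B < m" using Cons.prems(3) by auto
  have S: "set C \<subseteq> Rd d" "length C < m" if "C \<in> set S" for C using that Cons.prems(3) by auto
  have valR: "flow_deriv C y t \<in> Rd d" if "set C \<subseteq> Rd d" "length C \<le> m" "y \<in> Rd d" "t \<in> {0..T}" for C y t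
    using regularD(2)[OF reg(1)] that by auto
  have mapR: "set (map (\<lambda>B. flow_deriv B y t) S) \<subseteq> Rd d" if "y \<in> Rd d" "t \<in> {0..T}" for y t
    using valR[OF _ _ that] S by (simp add: image_subset_iff less_imp_le)
  have "unif_deriv d T (\<lambda>x t. \<Phi> x t (flow_deriv B x t))
      (\<lambda>t h. \<Phi>' t h (flow_deriv B x t) + \<Phi> x t (flow_deriv (proj d h # B) x t)) x"
  proof (rule unif_deriv_slot[where \<Phi> = \<Phi> and \<Phi>' = \<Phi>', OF x])
    fix b assume "b < d"
    then show "unif_deriv d T (\<lambda>x t. \<Phi> x t (unit_rseq b)) (\<lambda>t h. \<Phi>' t h (unit_rseq b)) x"
      using Cons.IH[of "cs @ [unit_rseq b]"] Cons.prems by (simp add: \<Phi>_def \<Phi>'_def)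
  next
    show "unif_deriv d T (flow_deriv B) (\<lambda>t h. flow_deriv (proj d h # B) x t) x"
      using regularD(4)[OF reg(1) B(1) x] B(2) by simp
  next
    fix y t assume yt: "y \<in> Rd d" "t \<in> {0..T}"
    show "flow_deriv B y t \<in> Rd d" using valR B yt by simp
    show "linear (\<lambda>w. \<Phi> y t (proj d w))"
      unfolding \<Phi>_def using Cons.prems(1,2) mapR[OF yt] flow_Rd[OF yt(1)]
      by (intro nth_deriv_linear[OF f_D]) simp_all
  next
    fix t h assume t: "t \<in> {0..T}"
    show "flow_deriv (proj d h # B) x t \<in> Rd d" using valR B x t by simp
    have 1: "linear (\<lambda>w. nth_deriv d f (flow d f x t)
        ((flow_deriv [proj d h] x t # cs) @ proj d w # map (\<lambda>B. flow_deriv B x t) S))"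
      using Cons.prems(1,2) mapR[OF x t] flow_Rd[OF x] valR[OF _ _ x t, of "[proj d h]"] reg(2)
      by (intro nth_deriv_linear[OF f_D]) simp_all
    have 2: "linear (\<lambda>w. nth_deriv d f (flow d f x t)
        (cs @ proj d w # map (\<lambda>B. flow_deriv B x t) (S[i := proj d h # S ! i])))" if i: "i < length S" for i
    proof -
      have "set C \<subseteq> Rd d \<and> length C \<le> m" if "C \<in> set (S[i := proj d h # S ! i])" for C
        using set_update_subset_insert[of S i "proj d h # S ! i"] that S[of C] S[of "S ! i"] i
        by fastforce
      then have "set (map (\<lambda>B. flow_deriv B x t) (S[i := proj d h # S ! i])) \<subseteq> Rd d"
        using valR[OF _ _ x t] by (simp only: set_map image_subset_iff) blast
      then show ?thesis
        using Cons.prems(1,2) flow_Rd[OF x] by (intro nth_deriv_linear[OF f_D]) simp_all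
    qed
    show "linear (\<lambda>w. \<Phi>' t h (proj d w))"
      unfolding \<Phi>'_def using 1 2 by (intro linear_compose_add linear_compose_sum) auto
  qed
  then show ?case
    by (rule unif_deriv_cong[OF _ x])
      (simp_all add: \<Phi>_def \<Phi>'_def sum.lessThan_Suc_shift del: sum.lessThan_Suc)
qed

lemma unif_deriv_term_value:
  assumes "regular m" "0 < m" "x \<in> Rd d" "length S < n" "\<And>B. B \<in> set S \<Longrightarrow> set B \<subseteq> Rd d \<and> length B < m"
  shows "unif_deriv d T (term_value S) (\<lambda>t h. \<Sum>S'\<leftarrow>expand (proj d h) S. term_value S' x t) x"
  by (rule unif_deriv_cong[OF unif_deriv_nth_deriv[OF assms(1-3), of "[]" S] assms(3)])
    (use assms in \<open>auto simp: term_value_def expand_def o_def interv_sum_list_conv_sum_set_nat atLeast0LessThan\<close>)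

lemma unif_deriv_const:
  assumes "\<And>t. t \<in> {0..T} \<Longrightarrow> norm (c t) \<le> K"
  shows "unif_deriv d T (\<lambda>x. c) (\<lambda>t h. 0) x"
  using assms by (intro unif_derivI[where K = K and K' = 0]) (auto simp: linear_zero)

text \<open>The inserted \<open>c\<close> does not depend on the parameter. This admits the top
  derivative of the flow frozen at \<open>x\<close>, whose own dependence on the parameter is not
  yet known to be differentiable.\<close>

lemma unif_deriv_Df:
  assumes reg: "regular m" "0 < m" "m < n" and x: "x \<in> Rd d"
    and c: "continuous_on {0..T} c" "\<And>t. t \<in> {0..T} \<Longrightarrow> c t \<in> Rd d"
  shows "unif_deriv d T (\<lambda>y t. nth_deriv d f (flow d f y t) [c t])
    (\<lambda>t h. nth_deriv d f (flow d f x t) [flow_deriv [proj d h] x t, c t]) x"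
proof -
  obtain K where K: "\<And>t. t \<in> {0..T} \<Longrightarrow> norm (c t) \<le> K"
    using compact_imp_bounded[OF compact_continuous_image[OF c(1) compact_Icc]]
    unfolding bounded_iff by blast
  have "unif_deriv d T (\<lambda>y t. nth_deriv d f (flow d f y t) [c t])
    (\<lambda>t h. nth_deriv d f (flow d f x t) [flow_deriv [proj d h] x t, c t]
      + nth_deriv d f (flow d f x t) [0]) x"
  proof (rule unif_deriv_slot[OF x _ unif_deriv_const[OF K]])
    fix b assume "b < d"
    then show "unif_deriv d T (\<lambda>y t. nth_deriv d f (flow d f y t) [unit_rseq b])
      (\<lambda>t h. nth_deriv d f (flow d f x t) [flow_deriv [proj d h] x t, unit_rseq b]) x"
      using unif_deriv_nth_deriv[OF reg(1,2) x, of "[unit_rseq b]" "[]"] reg by simp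
  next
    fix t h assume "t \<in> {0..T}"
    then show "linear (\<lambda>w. nth_deriv d f (flow d f x t) [flow_deriv [proj d h] x t, proj d w])"
      using nth_deriv_linear[OF f_D, of "[flow_deriv [proj d h] x t]" "[]" "flow d f x t"] reg
        regularD(2)[OF reg(1), of "[proj d h]" x t] flow_Rd x by simp
  qed (use c x flow_Rd Df_linear in auto)
  moreover have "nth_deriv d f (flow d f x t) [0] = 0" for t
    using linear_0[OF Df_linear[OF flow_Rd[OF x]]] by simp
  ultimately show ?thesis by simp
qed

lemma variational_equation_exists:
  assumes reg: "regular m" "m < n" and x: "x \<in> Rd d"
    and vs: "length vs = m" "set vs \<subseteq> Rd d" "v \<in> Rd d"
  shows "\<exists>z. z 0 = initial (v # vs) x \<and> (\<forall>t\<in>{0..T}. z t \<in> Rd d \<and>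
    (z has_vector_derivative nth_deriv d f (flow d f x t) [z t] + remainder (v # vs) x t)
      (at t within {0..T}))"
proof -
  \<comment> \<open>The existence result concerns the whole time axis, while the coefficients are
    controlled on \<open>{0..T}\<close> only; clamping time extends them by constants.\<close>
  define cl where "cl t = max 0 (min t T)" for t
  have cl: "cl t \<in> {0..T}" "t \<in> {0..T} \<Longrightarrow> cl t = t" for t
    using T_pos by (auto simp: cl_def)
  have cont: "continuous_on UNIV (\<lambda>t. c (cl t))" if "continuous_on {0..T} c" for c :: "real \<Rightarrow> rseq"
    using cl by (intro continuous_on_compose2[OF that]) (auto simp: cl_def intro!: continuous_intros)
  define F where "F t y = nth_deriv d f (flow d f x (cl t)) [y] + remainder (v # vs) x (cl t)" for t y
  have blocks: "length S \<le> n" "\<And>B. B \<in> set S \<Longrightarrow> set B \<subseteq> Rd d \<and> length B \<le> m"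
    if "S \<in> set (lower (v # vs))" for S
    using lower_blocks[OF that] vs reg(2) by fastforce+
  have flow_cont: "continuous_on UNIV (\<lambda>t. flow d f x (cl t))"
    using cont[OF regular_continuous[OF reg(1) _ x, of "[]"]] by simp
  have rem_cont: "continuous_on UNIV (\<lambda>t. remainder (v # vs) x (cl t))"
    unfolding remainder_def term_value_def
  proof (rule continuous_on_sum_list)
    fix S assume S: "S \<in> set (lower (v # vs))"
    have "continuous_on UNIV (\<lambda>t. nth_deriv d f (flow d f x (cl t))
        ([] @ map (\<lambda>w. w t) (map (\<lambda>B t. flow_deriv B x (cl t)) S)))"
      using blocks[OF S] x cl(1) regularD(2)[OF reg(1) _ x]
      by (intro nth_deriv_continuous_slots[OF f_C] flow_cont)
        (auto intro!: flow_Rd cont regular_continuous[OF reg(1)])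
    then show "continuous_on UNIV (\<lambda>t. nth_deriv d f (flow d f x (cl t)) (map (\<lambda>B. flow_deriv B x (cl t)) S))"
      by (simp add: o_def)
  qed
  have rem_Rd: "remainder (v # vs) x (cl t) \<in> Rd d" for t
    unfolding remainder_def term_value_def
  proof (rule Rd_sum_list)
    fix y assume "y \<in> set (map (\<lambda>S. nth_deriv d f (flow d f x (cl t)) (map (\<lambda>B. flow_deriv B x (cl t)) S))
        (lower (v # vs)))"
    then obtain S where S: "S \<in> set (lower (v # vs))"
      "y = nth_deriv d f (flow d f x (cl t)) (map (\<lambda>B. flow_deriv B x (cl t)) S)" by auto
    show "y \<in> Rd d"
      using blocks[OF S(1)] x cl(1) regularD(2)[OF reg(1) _ x] flow_Rd f_Rd unfolding S(2)
      by (intro nth_deriv_in_Rd[OF f_D]) auto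
  qed
  have "\<exists>z. z 0 = initial (v # vs) x \<and> (\<forall>t. z t \<in> Rd d \<and> (z has_vector_derivative F t (z t)) (at t))"
  proof (rule lipschitz_ode_exists[OF _ L1_pos])
    show "initial (v # vs) x \<in> Rd d" using vs x by (auto simp: initial_def)
  next
    fix t y assume y: "y \<in> Rd d"
    then show "F t y \<in> Rd d"
      unfolding F_def using rem_Rd n_pos x f_Rd
      by (intro Rd_closed_ops(2) nth_deriv_in_Rd[OF f_D] flow_Rd) auto
    fix z assume z: "z \<in> Rd d"
    show "norm (F t y - F t z) \<le> L 1 * norm (y - z)"
      using Df_bound[OF flow_Rd[OF x], of "y - z"] Df_diff[OF flow_Rd[OF x] y z] y z
      by (simp add: F_def)
  next
    fix u :: "real \<Rightarrow> rseq" assume u: "continuous_on UNIV u" "\<And>t. u t \<in> Rd d"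
    show "continuous_on UNIV (\<lambda>t. F t (u t))"
      unfolding F_def
      using nth_deriv_continuous_slots[OF f_C flow_cont, of "[u]" "[]"] u n_pos flow_Rd[OF x]
      by (intro continuous_on_add rem_cont) simp
  qed
  then obtain z where z: "z 0 = initial (v # vs) x" "\<And>t. z t \<in> Rd d"
    "\<And>t. (z has_vector_derivative F t (z t)) (at t)" by auto
  have "(z has_vector_derivative nth_deriv d f (flow d f x t) [z t] + remainder (v # vs) x t)
      (at t within {0..T})" if "t \<in> {0..T}" for t
    using has_vector_derivative_at_within[OF z(3)[of t], of "{0..T}"] cl(2)[OF that] by (simp add: F_def)
  then show ?thesis using z by blast
qed

end

lemma sum_list_concat_map:
  fixes \<phi> :: "'b \<Rightarrow> 'a::comm_monoid_add"
  shows "(\<Sum>b\<leftarrow>concat (map g as). \<phi> b) = (\<Sum>a\<leftarrow>as. \<Sum>b\<leftarrow>g a. \<phi> b)"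
  by (induction as) auto

lemma unif_deriv_uniformly_continuous:
  assumes "unif_deriv d T \<phi> \<phi>' x" "0 < \<eta>"
  shows "\<forall>\<^sub>F y in at x within Rd d. \<forall>t\<in>{0..T}. norm (\<phi> y t - \<phi> x t) \<le> \<eta>"
proof -
  obtain K where K: "0 < K" "\<And>t h. t \<in> {0..T} \<Longrightarrow> norm (\<phi>' t h) \<le> K * norm h"
    using unif_deriv_bound[OF assms(1)] by metis
  have "\<forall>t\<in>{0..T}. \<forall>h. norm (\<phi>' t h) \<le> K * norm h" using K(2) by blast
  note lip = unif_deriv_lipschitz[OF assms(1) this]
  have "0 < \<eta> / (K + 1)" using assms(2) K(1) by simp
  from lip eventually_norm_less[OF this, of x "Rd d"] show ?thesis
  proof eventually_elim
    case (elim y)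
    have "(K + 1) * norm (y - x) \<le> \<eta>"
      using elim(2) K(1) by (simp add: pos_less_divide_eq mult.commute)
    then show ?case using elim(1) by (meson order.trans)
  qed
qed

section \<open>Induction step: one more derivative of the flow\<close>

context smooth_field
begin

lemma Df_sum:
  assumes "p \<in> Rd d" "\<And>b. b < d \<Longrightarrow> w b \<in> Rd d"
  shows "nth_deriv d f p [\<Sum>b<d. c b *\<^sub>R w b] = (\<Sum>b<d. c b *\<^sub>R nth_deriv d f p [w b])"
proof -
  have "nth_deriv d f p [proj d (\<Sum>b<d. c b *\<^sub>R w b)] = (\<Sum>b<d. c b *\<^sub>R nth_deriv d f p [proj d (w b)])"
    by (simp only: linear_sum[OF Df_linear[OF assms(1)]] linear_scale[OF Df_linear[OF assms(1)]])
  moreover have "(\<Sum>b<d. c b *\<^sub>R w b) \<in> Rd d" using assms(2) by auto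
  ultimately show ?thesis using assms(2) by simp
qed

text \<open>The origin of the recursion for \<open>lower\<close>: differentiating the right-hand
  side of order \<open>m\<close>, with the top derivative frozen at \<open>x\<close>, gives the
  remainder of order \<open>m + 1\<close>.\<close>

lemma unif_deriv_remainder:
  assumes reg: "regular m" "m < n" and x: "x \<in> Rd d"
    and vs: "vs \<noteq> []" "length vs = m" "set vs \<subseteq> Rd d"
  shows "unif_deriv d T (\<lambda>y t. nth_deriv d f (flow d f y t) [flow_deriv vs x t] + remainder vs y t)
    (\<lambda>t h. remainder (proj d h # vs) x t) x"
proof -
  have m: "0 < m" using vs by auto
  have U: "unif_deriv d T (\<lambda>y t. nth_deriv d f (flow d f y t) [flow_deriv vs x t] + (\<Sum>S\<leftarrow>lower vs. term_value S y t))
    (\<lambda>t h. nth_deriv d f (flow d f x t) [flow_deriv [proj d h] x t, flow_deriv vs x t]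
      + (\<Sum>S\<leftarrow>lower vs. \<Sum>S'\<leftarrow>expand (proj d h) S. term_value S' x t)) x"
  proof (rule unif_deriv_add[OF unif_deriv_Df[OF reg(1) m reg(2) x] unif_deriv_sum_list])
    show "continuous_on {0..T} (flow_deriv vs x)"
      using regular_continuous[OF reg(1)] vs x by simp
    show "flow_deriv vs x t \<in> Rd d" if "t \<in> {0..T}" for t
      using regularD(2)[OF reg(1)] vs x that by simp
  next
    fix S assume S: "S \<in> set (lower vs)"
    have "length S < n" "\<And>B. B \<in> set S \<Longrightarrow> set B \<subseteq> Rd d \<and> length B < m"
      using lower_blocks[OF S] vs reg(2) by fastforce+
    then show "unif_deriv d T (term_value S) (\<lambda>t h. \<Sum>S'\<leftarrow>expand (proj d h) S. term_value S' x t) x"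
      by (intro unif_deriv_term_value[OF reg(1) m x]) auto
  qed
  show ?thesis
  proof (rule unif_deriv_cong[OF U x])
    obtain w ws where "vs = w # ws" using vs(1) by (cases vs) auto
    then show "remainder (proj d h # vs) x t =
        nth_deriv d f (flow d f x t) [flow_deriv [proj d h] x t, flow_deriv vs x t]
        + (\<Sum>S\<leftarrow>lower vs. \<Sum>S'\<leftarrow>expand (proj d h) S. term_value S' x t)" for t h
      by (simp add: remainder_def sum_list_concat_map term_value_def[of "[_, _]"])
  qed (simp add: remainder_def)
qed

text \<open>For nonempty \<open>vs\<close> the remainder is a derivative by
  \<open>unif_deriv_remainder\<close>, hence linear in the newest direction. Superposed solutions
  for unit directions therefore solve the equation for \<open>v\<close>.\<close>

lemma remainder_Cons_sum:
  assumes reg: "regular m" "m < n" and x: "x \<in> Rd d" and t: "t \<in> {0..T}"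
    and vs: "length vs = m" "set vs \<subseteq> Rd d" "v \<in> Rd d"
  shows "remainder (v # vs) x t = (\<Sum>b<d. coord v b *\<^sub>R remainder (unit_rseq b # vs) x t)"
proof (cases "vs = []")
  case False
  from unif_deriv_linear[OF unif_deriv_remainder[OF reg x False vs(1,2)] t] show ?thesis
    by (rule linear_proj_expand) (rule vs)
qed (simp add: remainder_def)

lemma flow_lipschitz:
  assumes "x \<in> Rd d" "y \<in> Rd d" "0 \<le> t"
  shows "norm (flow d f y t - flow d f x t) \<le> norm (y - x) * exp (L 1 * t)"
  using solutions_lipschitz[of 1 t "flow d f y" "flow d f x"] assms
  by (simp add: flow_Rd flow_0 flow_derivative)

text \<open>Provides the hypothesis \<open>err\<close> of \<open>unif_deriv_ode\<close>. At order 0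
  it follows from uniform differentiability of \<open>f\<close> along the compact trajectory. At
  higher orders the error splits into Df(U(y)) applied to the linearisation error, the expansion
  error with the top derivative frozen, and the change of Df(U) on a combination of the
  \<open>z b\<close> with coefficients of size at most \<open>norm (y - x)\<close>.\<close>

lemma linearisation_error:
  assumes reg: "regular m" "m < n" and x: "x \<in> Rd d" and vs: "length vs = m" "set vs \<subseteq> Rd d"
    and z: "\<And>b t. b < d \<Longrightarrow> t \<in> {0..T} \<Longrightarrow> z b t \<in> Rd d" "\<And>b. b < d \<Longrightarrow> continuous_on {0..T} (z b)"
    and \<epsilon>: "0 < \<epsilon>"
  shows "\<forall>\<^sub>F y in at x within Rd d. \<forall>t\<in>{0..T}.
    norm (variational_rhs vs y t - variational_rhs vs x t - (\<Sum>b<d. coord (y - x) b *\<^sub>R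
        (nth_deriv d f (flow d f x t) [z b t] + remainder (unit_rseq b # vs) x t)))
      \<le> L 1 * norm (flow_deriv vs y t - flow_deriv vs x t - (\<Sum>b<d. coord (y - x) b *\<^sub>R z b t))
        + \<epsilon> * norm (y - x)"
proof -
  let ?Z = "\<lambda>h t. \<Sum>b<d. coord h b *\<^sub>R z b t"
  have Z: "?Z h t \<in> Rd d" if "t \<in> {0..T}" for h t using z that by auto
  have DZ: "nth_deriv d f p [?Z h t] = (\<Sum>b<d. coord h b *\<^sub>R nth_deriv d f p [z b t])"
    if "p \<in> Rd d" "t \<in> {0..T}" for p h t
    using that z by (intro Df_sum) auto
  have split: "(\<Sum>b<d. coord h b *\<^sub>R (nth_deriv d f (flow d f x t) [z b t] + remainder (unit_rseq b # vs) x t))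
      = nth_deriv d f (flow d f x t) [?Z h t] + remainder (h # vs) x t"
    if "t \<in> {0..T}" "h \<in> Rd d" for t h
    using DZ[OF flow_Rd[OF x] that(1)] remainder_Cons_sum[OF reg x that(1) vs that(2)]
    by (simp add: scaleR_add_right sum.distrib)
  show ?thesis
  proof (cases "vs = []")
    case True
    \<comment> \<open>Compensates the Lipschitz constant \<open>exp (L 1 * T)\<close> of the flow in
      its initial value.\<close>
    define \<epsilon>' where "\<epsilon>' = \<epsilon> / exp (L 1 * T)"
    have \<epsilon>': "0 < \<epsilon>'" using \<epsilon> by (simp add: \<epsilon>'_def)
    have comp: "compact (flow d f x ` {0..T})"
      using regular_continuous[OF regular_0 _ x, of "[]"] by (intro compact_continuous_image) auto
    have "\<exists>\<delta>>0. \<forall>p\<in>flow d f x ` {0..T}. \<forall>q\<in>Rd d. norm (q - p) < \<delta> \<longrightarrow>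
        norm (f q - f p - nth_deriv d f p [q - p]) \<le> \<epsilon>' * norm (q - p)"
    proof (rule uniformly_differentiable_on_compact[where d = d and g' = "\<lambda>y h. nth_deriv d f y [h]",
          OF comp _ _ _ \<epsilon>'])
      show "(f has_derivative (\<lambda>h. nth_deriv d f y [proj d h])) (at y within Rd d)" if "y \<in> Rd d" for y
        using nth_deriv_has_derivative[OF f_D, of "[]" y] n_pos that by simp
      show "continuous_on (Rd d) (\<lambda>y. nth_deriv d f y [v])" if "v \<in> Rd d" for v
        using nth_deriv_continuous_on[OF f_C, of "[v]"] n_pos that by simp
    qed (use flow_Rd x in auto)
    then obtain \<delta> where \<delta>: "0 < \<delta>" "\<And>t q. t \<in> {0..T} \<Longrightarrow> q \<in> Rd d \<Longrightarrow> norm (q - flow d f x t) < \<delta> \<Longrightarrow>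
        norm (f q - f (flow d f x t) - nth_deriv d f (flow d f x t) [q - flow d f x t])
          \<le> \<epsilon>' * norm (q - flow d f x t)"
      by blast
    have "0 < \<delta> / exp (L 1 * T)" using \<delta>(1) by simp
    from eventually_norm_less[OF this, of x "Rd d"] eventually_within_mem[of "Rd d" x]
    show ?thesis
    proof eventually_elim
      case (elim y)
      show ?case
      proof
        fix t assume t: "t \<in> {0..T}"
        let ?p = "flow d f x t" and ?q = "flow d f y t" and ?h = "y - x"
        have R: "?p \<in> Rd d" "?q \<in> Rd d" "?h \<in> Rd d" using flow_Rd x elim by auto
        have exp: "exp (L 1 * t) \<le> exp (L 1 * T)" using t L1_pos by simp
        have qp: "norm (?q - ?p) \<le> norm ?h * exp (L 1 * T)"
          using flow_lipschitz[OF x elim(2), of t] mult_left_mono[OF exp norm_ge_zero[of ?h]] t by simp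
        also have "\<dots> < \<delta>" using elim(1) by (simp add: pos_less_divide_eq)
        finally have "norm (f ?q - f ?p - nth_deriv d f ?p [?q - ?p]) \<le> \<epsilon>' * norm (?q - ?p)"
          using \<delta>(2)[OF t R(2)] by simp
        also have "\<dots> \<le> \<epsilon>' * (norm ?h * exp (L 1 * T))"
          using qp \<epsilon>' by (intro mult_left_mono) auto
        also have "\<dots> = \<epsilon> * norm ?h" by (simp add: \<epsilon>'_def)
        finally have 1: "norm (f ?q - f ?p - nth_deriv d f ?p [?q - ?p]) \<le> \<epsilon> * norm ?h" .
        have 2: "norm (nth_deriv d f ?p [?q - ?p - ?Z ?h t]) \<le> L 1 * norm (?q - ?p - ?Z ?h t)"
          by (intro Df_bound R Rd_closed_ops(3) Z t)
        have "nth_deriv d f ?p [?q - ?p - ?Z ?h t] = nth_deriv d f ?p [?q - ?p] - nth_deriv d f ?p [?Z ?h t]"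
          by (intro Df_diff R Rd_closed_ops(3) Z t)
        then have eq: "f ?q - f ?p - nth_deriv d f ?p [?Z ?h t]
            = nth_deriv d f ?p [?q - ?p - ?Z ?h t] + (f ?q - f ?p - nth_deriv d f ?p [?q - ?p])"
          by simp
        have "norm (f ?q - f ?p - nth_deriv d f ?p [?Z ?h t])
            \<le> L 1 * norm (?q - ?p - ?Z ?h t) + \<epsilon> * norm ?h"
          unfolding eq by (rule norm_triangle_mono[OF 2 1])
        then show "norm (variational_rhs vs y t - variational_rhs vs x t - (\<Sum>b<d. coord ?h b *\<^sub>R
            (nth_deriv d f (flow d f x t) [z b t] + remainder (unit_rseq b # vs) x t)))
          \<le> L 1 * norm (flow_deriv vs y t - flow_deriv vs x t - ?Z ?h t) + \<epsilon> * norm ?h"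
          unfolding split[OF t R(3)] by (simp add: True variational_rhs_def remainder_def del: coord_simps)
      qed
    qed
  next
    case False
    then have m: "0 < m" using vs by auto
    define S where "S y t = nth_deriv d f (flow d f y t) [flow_deriv vs x t] + remainder vs y t" for y t
    \<comment> \<open>One half of \<open>\<epsilon>\<close> goes to the change of Df(U) on the
      \<open>d\<close> candidates \<open>z b\<close>, the other half to the expansion of
      \<open>S\<close>.\<close>
    define \<eta> where "\<eta> = \<epsilon> / 2 / (d + 1)"
    have \<eta>: "0 < \<eta>" "d * \<eta> \<le> \<epsilon> / 2"
      using \<epsilon> by (auto simp: \<eta>_def field_simps)
    have "\<forall>\<^sub>F y in at x within Rd d. \<forall>b\<in>{..<d}. \<forall>t\<in>{0..T}.
        norm (nth_deriv d f (flow d f y t) [z b t] - nth_deriv d f (flow d f x t) [z b t]) \<le> \<eta>"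
      using z \<eta>(1) by (intro eventually_ball_finite ballI
          unif_deriv_uniformly_continuous[OF unif_deriv_Df[OF reg(1) m reg(2) x]]) auto
    moreover have "\<forall>\<^sub>F y in at x within Rd d. \<forall>t\<in>{0..T}.
        norm (S y t - S x t - remainder (proj d (y - x) # vs) x t) \<le> \<epsilon> / 2 * norm (y - x)"
      using unif_deriv_eventually[OF unif_deriv_remainder[OF reg x False vs], of "\<epsilon> / 2"] \<epsilon>
      by (simp add: S_def)
    ultimately show ?thesis
      using eventually_within_mem[of "Rd d" x]
    proof eventually_elim
      case (elim y)
      show ?case
      proof
        fix t assume t: "t \<in> {0..T}"
        let ?p = "flow d f x t" and ?q = "flow d f y t" and ?h = "y - x"
        let ?e = "flow_deriv vs y t - flow_deriv vs x t - ?Z ?h t"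
        have R: "?p \<in> Rd d" "?q \<in> Rd d" "?h \<in> Rd d" "proj d ?h = ?h" using flow_Rd x elim by auto
        have wR: "flow_deriv vs y t \<in> Rd d" "flow_deriv vs x t \<in> Rd d"
          using regularD(2)[OF reg(1)] vs x elim t by auto
        have 1: "norm (nth_deriv d f ?q [?e]) \<le> L 1 * norm ?e"
          by (intro Df_bound R wR Rd_closed_ops(3) Z t)
        have 2: "norm (S y t - S x t - remainder (?h # vs) x t) \<le> \<epsilon> / 2 * norm ?h"
          using elim t R by auto
        have "norm (\<Sum>b<d. coord ?h b *\<^sub>R (nth_deriv d f ?q [z b t] - nth_deriv d f ?p [z b t]))
            \<le> (\<Sum>b<d. norm ?h * \<eta>)"
          unfolding norm_scaleR using elim t
          by (intro sum_norm_le) (auto intro!: mult_mono abs_coord_le simp del: coord_simps)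
        also have "\<dots> \<le> \<epsilon> / 2 * norm ?h"
          using mult_right_mono[OF \<eta>(2) norm_ge_zero[of ?h]] by (simp add: algebra_simps)
        finally have 3: "norm (\<Sum>b<d. coord ?h b *\<^sub>R (nth_deriv d f ?q [z b t] - nth_deriv d f ?p [z b t]))
            \<le> \<epsilon> / 2 * norm ?h" .
        have "(\<Sum>b<d. coord ?h b *\<^sub>R (nth_deriv d f ?q [z b t] - nth_deriv d f ?p [z b t]))
            = nth_deriv d f ?q [?Z ?h t] - nth_deriv d f ?p [?Z ?h t]"
          using DZ[OF R(1) t] DZ[OF R(2) t] by (simp add: scaleR_diff_right sum_subtractf del: coord_simps)
        moreover have "nth_deriv d f ?q [?e] = nth_deriv d f ?q [flow_deriv vs y t]
            - nth_deriv d f ?q [flow_deriv vs x t] - nth_deriv d f ?q [?Z ?h t]"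
          by (simp only: Df_diff R wR Rd_closed_ops(3) Z[OF t])
        ultimately have eq: "variational_rhs vs y t - variational_rhs vs x t
            - (nth_deriv d f ?p [?Z ?h t] + remainder (?h # vs) x t)
          = (nth_deriv d f ?q [?e] + (S y t - S x t - remainder (?h # vs) x t))
            + (\<Sum>b<d. coord ?h b *\<^sub>R (nth_deriv d f ?q [z b t] - nth_deriv d f ?p [z b t]))"
          using False by (simp add: S_def variational_rhs_def)
        have "norm (variational_rhs vs y t - variational_rhs vs x t
            - (nth_deriv d f ?p [?Z ?h t] + remainder (?h # vs) x t))
            \<le> (L 1 * norm ?e + \<epsilon> / 2 * norm ?h) + \<epsilon> / 2 * norm ?h"
          unfolding eq by (intro norm_triangle_mono 1 2 3)
        then show "norm (variational_rhs vs y t - variational_rhs vs x t - (\<Sum>b<d. coord ?h b *\<^sub>R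
            (nth_deriv d f (flow d f x t) [z b t] + remainder (unit_rseq b # vs) x t)))
          \<le> L 1 * norm ?e + \<epsilon> * norm ?h"
          unfolding split[OF t R(3)] by simp
      qed
    qed
  qed
qed

text \<open>Differentiability and the next equation arise together: \<open>unif_deriv_ode\<close>
  confirms the superposition of the solutions \<open>z b\<close> as a derivative, and uniqueness
  identifies it with the one selected by \<open>frechet_derivative\<close>.\<close>

lemma regular_step:
  assumes reg: "regular m" "m < n" and x: "x \<in> Rd d" and vs: "length vs = m" "set vs \<subseteq> Rd d"
  shows "unif_deriv d T (flow_deriv vs) (\<lambda>t h. flow_deriv (proj d h # vs) x t) x"
    and "v \<in> Rd d \<Longrightarrow> solves (v # vs) x"
proof -
  have "\<exists>z. z 0 = initial (unit_rseq b # vs) x \<and> (\<forall>t\<in>{0..T}. z t \<in> Rd d \<and>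
    (z has_vector_derivative nth_deriv d f (flow d f x t) [z t] + remainder (unit_rseq b # vs) x t)
      (at t within {0..T}))" if "b < d" for b
    using that by (intro variational_equation_exists[OF reg x vs]) auto
  then obtain z where z: "\<And>b. b < d \<Longrightarrow> z b 0 = initial (unit_rseq b # vs) x"
    "\<And>b t. b < d \<Longrightarrow> t \<in> {0..T} \<Longrightarrow> z b t \<in> Rd d"
    "\<And>b t. b < d \<Longrightarrow> t \<in> {0..T} \<Longrightarrow> (z b has_vector_derivative
      nth_deriv d f (flow d f x t) [z b t] + remainder (unit_rseq b # vs) x t) (at t within {0..T})"
    by metis
  let ?Z = "\<lambda>h t. \<Sum>b<d. coord h b *\<^sub>R z b t"
  have Z0: "?Z v 0 = initial (v # vs) x" if "v \<in> Rd d" for v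
    using that by (cases "vs = []") (simp_all add: z(1) initial_def Rd_eq_sum)
  have "flow_deriv vs y 0 - flow_deriv vs x 0 = initial ((y - x) # vs) x" if "y \<in> Rd d" for y
    using regularD(1)[OF reg(1)] vs x that by (auto simp: initial_def)
  then have init: "flow_deriv vs y 0 - flow_deriv vs x 0 = ?Z (y - x) 0" if "y \<in> Rd d" for y
    using that x by (simp only: Z0 Rd_closed_ops(3))
  have U: "unif_deriv d T (flow_deriv vs) (\<lambda>t h. ?Z h t) x"
  proof (rule unif_deriv_ode[where \<phi> = "flow_deriv vs" and z = z and g = "variational_rhs vs" and
        \<gamma> = "\<lambda>b t. nth_deriv d f (flow d f x t) [z b t] + remainder (unit_rseq b # vs) x t",
        OF L1_pos x _ z(3) init])
    show "(flow_deriv vs y has_vector_derivative variational_rhs vs y t) (at t within {0..T})"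
      if "y \<in> Rd d" "t \<in> {0..T}" for y t
      using regularD(3)[OF reg(1) vs(2) that(1) _ that(2)] vs(1) by simp
  qed (assumption | rule linearisation_error[OF reg x vs z(2) continuous_on_vector_derivative[OF z(3)]])+
  have eq: "flow_deriv (v # vs) x t = ?Z v t" if "v \<in> Rd d" "t \<in> {0..T}" for v t
    unfolding flow_deriv_Cons
    by (rule frechet_derivative_Rd[OF unif_deriv_has_derivative[OF U that(2)] x that(1)])
  show "unif_deriv d T (flow_deriv vs) (\<lambda>t h. flow_deriv (proj d h # vs) x t) x"
    by (rule unif_deriv_cong[OF U x]) (auto simp: eq coord_proj)
  show "solves (v # vs) x" if v: "v \<in> Rd d"
    unfolding solves_def
  proof (intro conjI ballI)
    show "flow_deriv (v # vs) x 0 = initial (v # vs) x"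
      using eq[OF v, of 0] Z0[OF v] T_pos by simp
    fix t assume t: "t \<in> {0..T}"
    show "flow_deriv (v # vs) x t \<in> Rd d" using eq[OF v t] z(2) t by auto
    have "(?Z v has_vector_derivative (\<Sum>b<d. coord v b *\<^sub>R
        (nth_deriv d f (flow d f x t) [z b t] + remainder (unit_rseq b # vs) x t))) (at t within {0..T})"
      using t by (intro has_vector_derivative_sum z(3)
          bounded_linear.has_vector_derivative[OF bounded_linear_scaleR_right]) auto
    also have "(\<Sum>b<d. coord v b *\<^sub>R
        (nth_deriv d f (flow d f x t) [z b t] + remainder (unit_rseq b # vs) x t))
      = variational_rhs (v # vs) x t"
      using Df_sum[OF flow_Rd[OF x, of t], where w = "\<lambda>b. z b t" and c = "coord v"] z(2)[OF _ t]
        remainder_Cons_sum[OF reg x t vs v]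
      by (simp add: variational_rhs_def eq[OF v t] scaleR_add_right sum.distrib)
    finally have Z': "(?Z v has_vector_derivative variational_rhs (v # vs) x t) (at t within {0..T})" .
    show "(flow_deriv (v # vs) x has_vector_derivative variational_rhs (v # vs) x t) (at t within {0..T})"
      by (rule has_vector_derivative_transform[OF t _ Z']) (rule eq[OF v])
  qed
qed

lemma regular_all: "m \<le> n \<Longrightarrow> regular m"
proof (induction m)
  case (Suc m)
  then have reg: "regular m" "m < n" by auto
  have "solves vs x" if vs: "set vs \<subseteq> Rd d" "x \<in> Rd d" "length vs \<le> Suc m" for vs x
  proof (cases "length vs \<le> m")
    case True
    then show ?thesis using reg(1) vs by (auto simp: regular_def)
  next
    case False
    then obtain w ws where "vs = w # ws" "length ws = m" using vs(3) by (cases vs) auto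
    then show ?thesis using regular_step(2)[OF reg vs(2), of ws w] vs(1) by simp
  qed
  moreover have "unif_deriv d T (flow_deriv vs) (\<lambda>t h. flow_deriv (proj d h # vs) x t) x"
    if "set vs \<subseteq> Rd d" "x \<in> Rd d" "length vs < Suc m" for vs x
    using regular_step(1)[OF reg that(2), of vs] regularD(4)[OF reg(1) that(1,2)] that
    by (cases "length vs = m") auto
  ultimately show ?case by (simp add: regular_def)
qed (simp add: regular_0)

end

subsection \<open>Bounds for the derivatives of the flow\<close>

text \<open>A bound on \<open>{0..T}\<close> for the flow derivatives of orders 1 to
  \<open>k\<close> in unit directions. The previous value covers the lower orders and the initial
  value, of norm at most 1; the added term bounds the deviation from it.\<close>

primrec growth :: "(nat \<Rightarrow> real) \<Rightarrow> real \<Rightarrow> nat \<Rightarrow> real" where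
  "growth L T 0 = 1"
| "growth L T (Suc k) = growth L T k +
    fact (Suc k) * (\<Sum>j=1..Suc k. L j) * growth L T k ^ Suc k / L 1 * exp (L 1 * T)"

text \<open>The quotient M / L_1 from Gronwall's inequality, with the inhomogeneity bound M as in
  \<open>remainder_bound\<close>. For \<open>k = 1\<close> and positive \<open>L 1\<close> it equals
  1.\<close>

definition increment_const :: "(nat \<Rightarrow> real) \<Rightarrow> real \<Rightarrow> nat \<Rightarrow> real"
  where "increment_const L T k = fact k * (\<Sum>j=1..k. L j) * growth L T (k - 1) ^ k / L 1"

lemma growth_Suc: "growth L T (Suc k) = growth L T k + increment_const L T (Suc k) * exp (L 1 * T)"
  by (simp add: increment_const_def)

lemma growth_ge_1:
  assumes "\<And>j. 1 \<le> j \<Longrightarrow> j \<le> k \<Longrightarrow> 0 < L j"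
  shows "1 \<le> growth L T k"
  using assms
proof (induction k)
  case (Suc k)
  have "0 \<le> (\<Sum>j=1..Suc k. L j)" using Suc.prems by (intro sum_nonneg less_imp_le) auto
  moreover have "1 \<le> growth L T k" "0 < L 1" using Suc by auto
  ultimately have "0 \<le> fact (Suc k) * (\<Sum>j=1..Suc k. L j) * growth L T k ^ Suc k / L 1 * exp (L 1 * T)"
    by (intro mult_nonneg_nonneg divide_nonneg_pos zero_le_power) auto
  then show ?case using \<open>1 \<le> growth L T k\<close> by simp
qed simp

lemma increment_const_pos:
  assumes "\<And>j. 1 \<le> j \<Longrightarrow> j \<le> k \<Longrightarrow> 0 < L j" "0 < k"
  shows "0 < increment_const L T k"
proof -
  have "0 < (\<Sum>j=1..k. L j)" using assms by (intro sum_pos) auto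
  moreover have "1 \<le> growth L T (k - 1)" "0 < L 1"
    using assms by (auto intro!: growth_ge_1)
  ultimately show ?thesis
    unfolding increment_const_def by (intro divide_pos_pos mult_pos_pos zero_less_power) auto
qed

lemma norm_sum_list_le:
  fixes \<phi> :: "'b \<Rightarrow> 'a::real_normed_vector"
  shows "norm (\<Sum>a\<leftarrow>as. \<phi> a) \<le> (\<Sum>a\<leftarrow>as. norm (\<phi> a))"
proof (induction as)
  case (Cons a as)
  then show ?case using norm_triangle_ineq[of "\<phi> a" "\<Sum>a\<leftarrow>as. \<phi> a"] by simp
qed simp

lemma prod_list_le_power:
  fixes B :: real
  shows "(\<And>x. x \<in> set xs \<Longrightarrow> 0 \<le> x \<and> x \<le> B) \<Longrightarrow> prod_list xs \<le> B ^ length xs"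
proof (induction xs)
  case (Cons x xs)
  have "0 \<le> prod_list xs" by (rule prod_list_nonneg) (use Cons.prems in auto)
  moreover have "0 \<le> B" using Cons.prems[of x] by force
  ultimately show ?case using Cons by (auto intro!: mult_mono)
qed simp

context smooth_field
begin

text \<open>A term with m blocks costs \<open>L m\<close>, replaced by the sum of all
  \<open>L j\<close>, and at most \<open>G ^ m\<close> for the blocks, replaced by
  \<open>G ^ k\<close> since \<open>1 \<le> G\<close>; \<open>length_lower\<close> counts the
  terms.\<close>

lemma remainder_bound:
  assumes L: "\<And>j. 1 \<le> j \<Longrightarrow> j \<le> k \<Longrightarrow> 0 < L j" and k: "k \<le> n" "length vs = k" "set vs \<subseteq> Rd d" "vs \<noteq> []"
    and x: "x \<in> Rd d" and t: "t \<in> {0..T}" and G: "1 \<le> G"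
    and bound: "\<And>B. B \<noteq> [] \<Longrightarrow> length B < k \<Longrightarrow> set B \<subseteq> set vs \<Longrightarrow> norm (flow_deriv B x t) \<le> G"
  shows "norm (remainder vs x t) \<le> fact k * (\<Sum>j=1..k. L j) * G ^ k"
proof -
  have L0: "0 \<le> (\<Sum>j=1..k. L j)" using L by (intro sum_nonneg less_imp_le) auto
  have S: "norm (term_value S x t) \<le> (\<Sum>j=1..k. L j) * G ^ k" if "S \<in> set (lower vs)" for S
  proof -
    note S = lower_blocks[OF that]
    have R: "flow_deriv B x t \<in> Rd d" if "B \<in> set S" for B
      using regularD(2)[OF regular_all[OF order_refl] _ x _ t, of B] S that k by fastforce
    have len: "1 \<le> length S" "length S \<le> k" using S k by (auto simp: Suc_le_eq)
    have "norm (term_value S x t) \<le> L (length S) * prod_list (map norm (map (\<lambda>B. flow_deriv B x t) S))"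
      unfolding term_value_def
      using f_bound[of "flow d f x t" "map (\<lambda>B. flow_deriv B x t) S"] flow_Rd[OF x] S R len k
      by (simp add: image_subset_iff)
    also have "\<dots> \<le> (\<Sum>j=1..k. L j) * G ^ k"
    proof (rule mult_mono)
      show "L (length S) \<le> (\<Sum>j=1..k. L j)"
        using L len by (intro member_le_sum less_imp_le) auto
      have "prod_list (map norm (map (\<lambda>B. flow_deriv B x t) S)) \<le> G ^ length S"
      proof -
        have "0 \<le> r \<and> r \<le> G" if "r \<in> set (map norm (map (\<lambda>B. flow_deriv B x t) S))" for r
          using that bound S k(2) by auto
        then have "prod_list (map norm (map (\<lambda>B. flow_deriv B x t) S))
            \<le> G ^ length (map norm (map (\<lambda>B. flow_deriv B x t) S))"
          by (rule prod_list_le_power)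
        then show ?thesis by simp
      qed
      also have "\<dots> \<le> G ^ k" using len G by (intro power_increasing) auto
      finally show "prod_list (map norm (map (\<lambda>B. flow_deriv B x t) S)) \<le> G ^ k" .
    qed (use L0 in \<open>auto intro!: prod_list_nonneg\<close>)
    finally show ?thesis .
  qed
  have "norm (remainder vs x t) \<le> (\<Sum>S\<leftarrow>lower vs. norm (term_value S x t))"
    unfolding remainder_def by (rule norm_sum_list_le)
  also have "\<dots> \<le> (\<Sum>S\<leftarrow>lower vs. (\<Sum>j=1..k. L j) * G ^ k)"
    using S by (intro sum_list_mono)
  also have "\<dots> = real (length (lower vs)) * ((\<Sum>j=1..k. L j) * G ^ k)"
    by (simp add: sum_list_triv)
  also have "\<dots> \<le> fact k * ((\<Sum>j=1..k. L j) * G ^ k)"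
  proof (rule mult_right_mono)
    have "real (length (lower vs)) \<le> real (fact k)"
      using length_lower[OF k(4)] k(2) by (intro of_nat_mono less_imp_le) simp
    then show "real (length (lower vs)) \<le> fact k" by simp
  qed (use L0 G in simp)
  finally show ?thesis by (simp add: mult.assoc)
qed

text \<open>After subtraction of the initial value, Gronwall's inequality starts from 0; this leaves
  exactly the factor \<open>exp (L 1 * t) - 1\<close>.\<close>

lemma flow_deriv_increment_bound:
  assumes L: "\<And>j. 1 \<le> j \<Longrightarrow> j \<le> k \<Longrightarrow> 0 < L j" and k: "k \<le> n" "length vs = k" "vs \<noteq> []"
    and vs: "\<And>v. v \<in> set vs \<Longrightarrow> v \<in> Rd d \<and> norm v = 1"
    and x: "x \<in> Rd d" and t: "t \<in> {0..T}"
    and bound: "\<And>B s. B \<noteq> [] \<Longrightarrow> length B < k \<Longrightarrow> set B \<subseteq> set vs \<Longrightarrow> s \<in> {0..T} \<Longrightarrow>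
      norm (flow_deriv B x s) \<le> growth L T (k - 1)"
  shows "norm (flow_deriv vs x t - initial vs x) \<le> increment_const L T k * (exp (L 1 * t) - 1)"
proof -
  define M where "M = increment_const L T k * L 1"
  have vsR: "set vs \<subseteq> Rd d" using vs by auto
  have iR: "initial vs x \<in> Rd d" using vs k by (auto simp: initial_def)
  have G: "1 \<le> growth L T (k - 1)" using L by (intro growth_ge_1) auto
  have "k \<noteq> 0" using k by auto
  then have "k = 1 \<or> 2 \<le> k" by linarith
  \<comment> \<open>For \<open>k = 1\<close> the remainder is empty and only Df(U) applied to the
    direction is left; for larger \<open>k\<close> the initial value vanishes and only the remainder
    is left.\<close>
  then have M: "norm (nth_deriv d f (flow d f x s) [initial vs x] + remainder vs x s) \<le> M" if "s \<in> {0..T}" for s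
  proof
    assume k1: "k = 1"
    then obtain v where v: "vs = [v]" using k by (cases vs) auto
    have "norm (nth_deriv d f (flow d f x s) [v]) \<le> L 1 * 1"
      using Df_bound[OF flow_Rd[OF x], of v s] vs[of v] v by simp
    then show ?thesis using k1 L1_pos by (simp add: v initial_def remainder_def M_def increment_const_def)
  next
    assume k2: "2 \<le> k"
    have "nth_deriv d f (flow d f x s) [0] = 0"
      using linear_0[OF Df_linear[OF flow_Rd[OF x]]] by simp
    moreover have "norm (remainder vs x s) \<le> fact k * (\<Sum>j=1..k. L j) * growth L T (k - 1) ^ k"
      using bound that by (intro remainder_bound[OF L k(1,2) vsR k(3) x that G]) auto
    ultimately show ?thesis
      using k2 k L1_pos by (simp add: initial_def M_def increment_const_def)
  qed
  have "norm (flow_deriv vs x t - initial vs x)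
      \<le> norm (flow_deriv vs x 0 - initial vs x) * exp (L 1 * t) + M / L 1 * (exp (L 1 * t) - 1)"
  proof (rule gronwall[where e = "\<lambda>t. flow_deriv vs x t - initial vs x" and T = T and e' = "variational_rhs vs x"])
    fix s assume s: "s \<in> {0..T}"
    have wR: "flow_deriv vs x s \<in> Rd d"
      using regularD(2)[OF regular_all[OF order_refl] vsR x _ s] k by simp
    have "(flow_deriv vs x has_vector_derivative variational_rhs vs x s) (at s within {0..T})"
      using regularD(3)[OF regular_all[OF order_refl] vsR x _ s] k by simp
    from has_vector_derivative_diff[OF this has_vector_derivative_const]
    show "((\<lambda>t. flow_deriv vs x t - initial vs x) has_vector_derivative variational_rhs vs x s) (at s within {0..T})"
      by simp
    have "variational_rhs vs x s = nth_deriv d f (flow d f x s) [flow_deriv vs x s - initial vs x]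
        + (nth_deriv d f (flow d f x s) [initial vs x] + remainder vs x s)"
      using k Df_diff[OF flow_Rd[OF x] wR iR] by (simp add: variational_rhs_def)
    also have "norm \<dots> \<le> L 1 * norm (flow_deriv vs x s - initial vs x) + M"
      using wR iR by (intro norm_triangle_mono M s Df_bound flow_Rd x) auto
    finally show "norm (variational_rhs vs x s) \<le> L 1 * norm (flow_deriv vs x s - initial vs x) + M" .
  next
    show "0 \<le> M" using order.trans[OF norm_ge_zero M[of 0]] T_pos by simp
  qed (use L1_pos t in auto)
  moreover have "flow_deriv vs x 0 = initial vs x"
    using regularD(1)[OF regular_all[OF order_refl] vsR x] k by simp
  ultimately show ?thesis using L1_pos by (simp add: M_def)
qed

text \<open>All orders up to \<open>k\<close> are bounded together because the blocks in a remainder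
  can have any smaller length.\<close>

lemma flow_deriv_bound:
  assumes L: "\<And>j. 1 \<le> j \<Longrightarrow> j \<le> k \<Longrightarrow> 0 < L j" and "k \<le> n" "length vs \<le> k" "vs \<noteq> []"
    and "\<And>v. v \<in> set vs \<Longrightarrow> v \<in> Rd d \<and> norm v = 1"
    and x: "x \<in> Rd d" and "t \<in> {0..T}"
  shows "norm (flow_deriv vs x t) \<le> growth L T k"
  using assms
proof (induction k arbitrary: vs t)
  case (Suc k)
  have C: "0 < increment_const L T (Suc k)" using Suc.prems(1) by (rule increment_const_pos) auto
  have IH: "norm (flow_deriv B x s) \<le> growth L T k"
    if "B \<noteq> []" "length B \<le> k" "set B \<subseteq> set vs" "s \<in> {0..T}" for B s
    using that Suc.prems by (intro Suc.IH) auto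
  show ?case
  proof (cases "length vs \<le> k")
    case True
    then have "norm (flow_deriv vs x t) \<le> growth L T k"
      using Suc.prems by (intro IH) auto
    also have "\<dots> \<le> growth L T (Suc k)" unfolding growth_Suc using C by simp
    finally show ?thesis .
  next
    case False
    then have len: "length vs = Suc k" using Suc.prems by simp
    have inc: "norm (flow_deriv vs x t - initial vs x) \<le> increment_const L T (Suc k) * (exp (L 1 * t) - 1)"
      using Suc.prems IH len by (intro flow_deriv_increment_bound) auto
    have ini: "norm (initial vs x) \<le> growth L T k"
    proof -
      have "norm (initial vs x) \<le> 1" using Suc.prems(4,5) by (auto simp: initial_def)
      also have "1 \<le> growth L T k" using Suc.prems(1) by (intro growth_ge_1) auto
      finally show ?thesis .
    qed
    have "exp (L 1 * t) \<le> exp (L 1 * T)" using Suc.prems L1_pos by simp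
    then have "exp (L 1 * t) - 1 \<le> exp (L 1 * T)" by linarith
    then have "increment_const L T (Suc k) * (exp (L 1 * t) - 1) \<le> increment_const L T (Suc k) * exp (L 1 * T)"
      using C by (intro mult_left_mono) auto
    then show ?thesis
      unfolding growth_Suc using inc ini norm_triangle_ineq2[of "flow_deriv vs x t" "initial vs x"] by linarith
  qed
qed simp

section \<open>From the flow to the increment\<close>

lemma initial_has_derivative:
  "x \<in> Rd d \<Longrightarrow> (initial vs has_derivative (\<lambda>h. initial (proj d h # vs) x)) (at x within Rd d)"
  using has_derivative_proj[OF has_derivative_ident, of x d]
  by (cases "vs = []") (simp_all add: initial_def[abs_def])

lemma flow_deriv_minus_initial_has_derivative:
  assumes "set vs \<subseteq> Rd d" "length vs < n" "x \<in> Rd d" "t \<in> {0..T}"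
  shows "((\<lambda>y. flow_deriv vs y t - initial vs y) has_derivative
    (\<lambda>h. flow_deriv (proj d h # vs) x t - initial (proj d h # vs) x)) (at x within Rd d)"
  by (intro has_derivative_diff initial_has_derivative
      unif_deriv_has_derivative[OF regularD(4)[OF regular_all[OF order_refl]]] assms)

lemma nth_deriv_increment:
  assumes "set vs \<subseteq> Rd d" "length vs \<le> n" "x \<in> Rd d" "t \<in> {0..T}"
  shows "nth_deriv d (increment d f t) x vs = flow_deriv vs x t - initial vs x"
  using assms
proof (induction vs arbitrary: x)
  case Nil
  then show ?case by (simp add: increment_def initial_def)
next
  case (Cons v vs)
  have "((\<lambda>y. nth_deriv d (increment d f t) y vs) has_derivative
      (\<lambda>h. flow_deriv (proj d h # vs) x t - initial (proj d h # vs) x)) (at x within Rd d)"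
    by (rule has_derivative_transform[OF _ _ flow_deriv_minus_initial_has_derivative])
      (use Cons in auto)
  from frechet_derivative_Rd[OF this, of v] Cons.prems show ?case
    by (simp add: nth_deriv.simps(2))
qed

lemma increment_n_times_differentiable:
  assumes "t \<in> {0..T}"
  shows "n_times_differentiable d n (increment d f t)"
  unfolding n_times_differentiable_def differentiable_on_def
proof (intro allI impI ballI)
  fix vs x assume vs: "set vs \<subseteq> Rd d \<and> length vs < n" and x: "x \<in> Rd d"
  have "((\<lambda>y. nth_deriv d (increment d f t) y vs) has_derivative
      (\<lambda>h. flow_deriv (proj d h # vs) x t - initial (proj d h # vs) x)) (at x within Rd d)"
    by (rule has_derivative_transform[OF _ _ flow_deriv_minus_initial_has_derivative])
      (use nth_deriv_increment vs x assms in auto)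
  then show "(\<lambda>y. nth_deriv d (increment d f t) y vs) differentiable (at x within Rd d)"
    by (rule differentiableI)
qed

lemma nth_deriv_increment_bound:
  assumes "\<And>j. 1 \<le> j \<Longrightarrow> j \<le> n \<Longrightarrow> 0 < L j" "length vs = n"
    and "\<And>v. v \<in> set vs \<Longrightarrow> v \<in> Rd d \<and> norm v = 1" and "x \<in> Rd d" "t \<in> {0..T}"
  shows "norm (nth_deriv d (increment d f t) x vs) \<le> increment_const L T n * (exp (L 1 * t) - 1)"
proof -
  have "norm (flow_deriv vs x t - initial vs x) \<le> increment_const L T n * (exp (L 1 * t) - 1)"
    using assms n_pos
    by (intro flow_deriv_increment_bound flow_deriv_bound) auto
  then show ?thesis using nth_deriv_increment[of vs x t] assms by (simp add: subset_iff)
qed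

end

text \<open>The constant sees only \<open>k\<close>, the time bound and the list of
  \<open>L 1\<close> to \<open>L k\<close>, and precedes the dimension and \<open>f\<close>.
  Differentiability accompanies the bound because \<open>frechet_derivative\<close> is informative
  only where a derivative exists.\<close>

theorem corollaryE12:
  shows "\<exists>C :: nat \<Rightarrow> real \<Rightarrow> real list \<Rightarrow> real.
    \<forall>(d::nat) (\<beta>::nat) (L :: nat \<Rightarrow> real) (k::nat) (f :: rseq \<Rightarrow> rseq) (\<Delta>t\<^sub>0::real) (\<Delta>t::real).
      (\<forall>j\<in>{1..\<beta>}. 0 < L j) \<and> k \<in> {1..\<beta>} \<and>
      f \<in> Rd d \<rightarrow> Rd d \<and> n_times_continuously_differentiable d \<beta> f \<and>
      (\<forall>j\<in>{1..\<beta>}. (SUP x\<in>Rd d. op_norm d j (nth_deriv d f x)) \<le> ennreal (L j)) \<and>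
      0 < \<Delta>t\<^sub>0 \<and> \<Delta>t \<in> {0..\<Delta>t\<^sub>0}
      \<longrightarrow> 0 < C k \<Delta>t\<^sub>0 (map L [1..<Suc k]) \<and>
          n_times_differentiable d k (increment d f \<Delta>t) \<and>
          (SUP x\<in>Rd d. op_norm d k (nth_deriv d (increment d f \<Delta>t) x))
            \<le> ennreal (C k \<Delta>t\<^sub>0 (map L [1..<Suc k]) * (exp (L 1 * \<Delta>t) - 1))"
\<comment> \<open>List positions start at 0, so the bound of order \<open>j\<close> is found at
  \<open>j - 1\<close>.\<close>
proof (rule exI[of _ "\<lambda>k T Ls. increment_const (\<lambda>j. Ls ! (j - 1)) T k"], intro allI impI, elim conjE)
  fix d \<beta> :: nat and L :: "nat \<Rightarrow> real" and k :: nat and f :: "rseq \<Rightarrow> rseq" and T t :: real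
  assume L: "\<forall>j\<in>{1..\<beta>}. 0 < L j" and k: "k \<in> {1..\<beta>}" and f: "f \<in> Rd d \<rightarrow> Rd d"
    "n_times_continuously_differentiable d \<beta> f"
    and bound: "\<forall>j\<in>{1..\<beta>}. (SUP x\<in>Rd d. op_norm d j (nth_deriv d f x)) \<le> ennreal (L j)"
    and T: "0 < T" and t: "t \<in> {0..T}"
  \<comment> \<open>The sequence read off the list; it agrees with \<open>L\<close> on the orders 1
    to \<open>k\<close>, and the locale is entered with order \<open>k\<close>.\<close>
  define L' where "L' j = map L [1..<Suc k] ! (j - 1)" for j
  have L': "L' j = L j" if "1 \<le> j" "j \<le> k" for j
    using that by (simp add: L'_def del: upt_Suc)
  have L'_pos: "0 < L' j" if "1 \<le> j" "j \<le> k" for j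
    using that L k by (simp add: L')
  have f_D: "n_times_differentiable d \<beta> f"
    by (rule n_times_continuously_differentiable_imp_differentiable[OF f(2)])
  interpret smooth_field d k f L' T
  proof
    show "n_times_continuously_differentiable d k f"
      using n_times_continuously_differentiable_mono[OF f(2)] k by simp
    fix x vs assume x: "x \<in> Rd d" and vs: "vs \<noteq> []" "length vs \<le> k" "set vs \<subseteq> Rd d"
    then have len: "1 \<le> length vs" "length vs \<le> k" "length vs \<in> {1..\<beta>}"
      using k by (auto simp: Suc_le_eq)
    have L0: "0 \<le> L (length vs)" using L len(3) by (simp add: less_imp_le)
    have "norm (nth_deriv d f x us) \<le> L (length vs)"
      if "length us = length vs" "\<forall>v\<in>set us. v \<in> Rd d \<and> norm v = 1" for us
      using bound len(3) op_norm_SUP_le_iff[OF L0, of d "length vs" "nth_deriv d f" "Rd d"] x that by blast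
    moreover have "length vs \<le> \<beta>" using len(3) by simp
    ultimately show "norm (nth_deriv d f x vs) \<le> L' (length vs) * prod_list (map norm vs)"
      unfolding L'[OF len(1,2)] by (intro nth_deriv_norm_le[OF f_D L0 _ x _ refl vs(3)])
  qed (use k f(1) T L'_pos in auto)
  have "0 < increment_const L' T k"
    using k L'_pos by (intro increment_const_pos) auto
  moreover from this have "(SUP x\<in>Rd d. op_norm d k (nth_deriv d (increment d f t) x))
      \<le> ennreal (increment_const L' T k * (exp (L 1 * t) - 1))"
    using nth_deriv_increment_bound[OF L'_pos _ _ _ t] L'[of 1] k L'_pos[of 1] t
    by (subst op_norm_SUP_le_iff) (auto intro!: mult_nonneg_nonneg)
  ultimately show "0 < increment_const (\<lambda>j. map L [1..<Suc k] ! (j - 1)) T k \<and>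
      n_times_differentiable d k (increment d f t) \<and>
      (SUP x\<in>Rd d. op_norm d k (nth_deriv d (increment d f t) x))
        \<le> ennreal (increment_const (\<lambda>j. map L [1..<Suc k] ! (j - 1)) T k * (exp (L 1 * t) - 1))"
    using increment_n_times_differentiable[OF t] by (simp add: L'_def[abs_def] del: upt_Suc)
qed

end
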